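(* Let $X$ and $Y$ be Banach spaces such that the space $\mathcal{K}(X,Y)$ of compact operators is an $M$-ideal in the space $\mathcal{L}(X,Y)$ of bounded operators. Then any $\tau \in \partial_e \mathcal{L}(X,Y)^*_1$ that is a $w^*$-$w$ point of continuity is of the form $x \otimes y^*$, where $x \in \partial_e X^{**}_1$ is a $w^*$-$w$ point of continuity and $y^* \in \partial_e Y^*_1$ is also a $w^*$-$w$ point of continuity.
   Context: For a Banach space $Z$, $Z_1$ denotes its closed unit ball and $\partial_e Z_1$ the set of extreme points of $Z_1$. An element $z^* \in Z^*_1$ is a $w^*$-$w$ point of continuity (of $Z^*_1$) if the identity map $(Z^*_1, w^* ) \to (Z^*_1, \text{weak})$ is continuous at $z^*$; here this is used with $Z = \mathcal{L}(X,Y)$, $Z = X^*$ and $Z = Y$. For $x \in X^{**}$ and $y^* \in Y^*$, $x \otimes y^*$ is the functional on operators $S : X \to Y$ given by $(x \otimes y^* )(S) = x(S^*(y^* ))$. A closed subspace $M$ of a Banach space $Z$ is an $M$-ideal in $Z$ if there is a linear projection $P : Z^* \to Z^*$ with $\|P(z^* )\| + \|z^* - P(z^* )\| = \|z^*\|$ for all $z^* \in Z^*$ and $\ker P = M^\perp$. *)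

theory Defs
  imports "HOL-Analysis.Analysis"
begin

(* Scalars are real. 'z \<Rightarrow>\<^sub>L real is the Banach dual of 'z, with the operator norm. *)
type_synonym 'z dual = "'z \<Rightarrow>\<^sub>L real"

definition weak_topology :: "'z::real_normed_vector topology" where
  "weak_topology = pullback_topology UNIV (\<lambda>z (f :: 'z dual). blinfun_apply f z) euclidean"

(* Here euclidean is the product topology on functions from 'z to the reals. *)
definition weak_star_topology :: "'z::real_normed_vector dual topology" where
  "weak_star_topology = pullback_topology UNIV blinfun_apply euclidean"

definition weak_star_weak_pc :: "'z::real_normed_vector dual \<Rightarrow> bool" where
  "weak_star_weak_pc f \<longleftrightarrow>
     topcontinuous_at (subtopology weak_star_topology (cball 0 1))
                      (subtopology weak_topology (cball 0 1)) (\<lambda>g. g) f"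

definition compact_operators :: "('x::real_normed_vector \<Rightarrow>\<^sub>L 'y::real_normed_vector) set" where
  "compact_operators = {T. compact (closure (blinfun_apply T ` cball 0 1))}"

definition annihilator :: "'z::real_normed_vector set \<Rightarrow> 'z dual set" where
  "annihilator M = {f. \<forall>m\<in>M. blinfun_apply f m = 0}"

definition M_ideal :: "'z::real_normed_vector set \<Rightarrow> bool" where
  "M_ideal M \<longleftrightarrow> subspace M \<and> closed M \<and>
     (\<exists>P :: 'z dual \<Rightarrow> 'z dual. linear P \<and> P \<circ> P = P \<and>
        (\<forall>f. norm (P f) + norm (f - P f) = norm f) \<and>
        {f. P f = 0} = annihilator M)"

lift_definition dual_operator ::
  "('x::real_normed_vector \<Rightarrow>\<^sub>L 'y::real_normed_vector) \<Rightarrow> 'y dual \<Rightarrow>\<^sub>L 'x dual"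
  is "\<lambda>S y. y o\<^sub>L S"
  by (rule bounded_bilinear.bounded_linear_left[OF bounded_bilinear_blinfun_compose])

lift_definition tensor_functional ::
  "('x::real_normed_vector) dual dual \<Rightarrow> ('y::real_normed_vector) dual \<Rightarrow> ('x \<Rightarrow>\<^sub>L 'y) dual"
  is "\<lambda>x y S. blinfun_apply x (blinfun_apply (dual_operator S) y)"
  unfolding dual_operator.rep_eq
  by (intro bounded_linear_compose[OF blinfun.bounded_linear_right]
      bounded_bilinear.bounded_linear_right[OF bounded_bilinear_blinfun_compose])

(* Applications of these notions assume both X and Y nonzero. If X = 0, then L(X,Y)* = 0, whose
   only element 0 is an extreme point of its unit ball and a point of continuity, whereas the dual
   unit ball of, say, Y = C[0,1] has no extreme point that is a w*-w point of continuity. *)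

end

theory Submission
  imports Defs
begin

text \<open>Let \<open>P\<close> be the projection belonging to the M-ideal of compact operators. The proof rests on three
  facts about the elementary tensors \<open>x \<otimes> y\<close>, where \<open>x\<close> is in the bidual of \<open>X\<close> and \<open>y\<close> in the dual of \<open>Y\<close>.
  \<^item> Those with factors in the unit balls norm all bounded operators (\<open>tensor_functionals_norming\<close>).
  \<^item> Rank-one operators already detect their norm, so they lie in the range of \<open>P\<close>
    (\<open>M_ideal_projection_tensor_functional\<close>).
  \<^item> Tested on a compact operator, they depend jointly weak-star continuously on their factors in the
    balls (\<open>continuous_map_tensor_functional\<close>).

  By the first two facts the unit ball of the range of \<open>P\<close> is norming, hence weak-star dense in the dual
  ball. At the point of continuity \<open>\<tau>\<close> this density becomes weak density, and the range is weakly
  closed, so \<open>P \<tau> = \<tau>\<close> (\<open>M_ideal_pc_fixed\<close>).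

  As \<open>\<tau>\<close> is extreme, the argument of Milman's theorem applies to the norming family of elementary
  tensors, parametrized by a product of two weak-star compact balls: \<open>\<tau>\<close> agrees on the compact
  operators with some \<open>x \<otimes> y\<close> (\<open>extreme_point_in_norming_family\<close>). Both functionals are fixed by \<open>P\<close>,
  which depends only on the restriction to the compact operators, so \<open>\<tau> = x \<otimes> y\<close>.

  Extremality passes to the factors by linearity. For the continuity of \<open>x\<close>, the map
  \<open>x \<mapsto> x \<otimes> y\<close> is weak-star continuous and has a bounded left inverse. For \<open>y\<close>, the map \<open>y \<mapsto> x \<otimes> y\<close>
  converges at first only on compact operators; but a norm-one functional in the range of \<open>P\<close>
  is the only element of the dual ball with its restriction to the M-ideal, so by compactness of the
  ball convergence on the M-ideal is weak-star convergence (\<open>M_ideal_topcontinuous_extend\<close>).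

  The convexity part uses two self-contained ingredients: a Hahn--Banach theorem by way of minimal
  sublinear functionals, and the weak-star density of norming convex sets, where an almost
  minimizer of a sum of squares takes the place of a separating hyperplane.\<close>

section \<open>Functionals attaining the norm of a vector\<close>

definition sublinear :: "('z::real_vector \<Rightarrow> real) \<Rightarrow> bool" where
  "sublinear q \<longleftrightarrow>
     (\<forall>x y. q (x + y) \<le> q x + q y) \<and> (\<forall>c>0. \<forall>x. q (c *\<^sub>R x) \<le> c * q x)"

lemma sublinear_zero:
  assumes "sublinear q" shows "q 0 = 0"
proof -
  have "q (2 *\<^sub>R 0) \<le> 2 * q 0" "q ((1/2) *\<^sub>R 0) \<le> (1/2) * q 0"
    using assms unfolding sublinear_def by (metis zero_less_numeral, metis half_gt_zero_iff zero_less_one)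
  then show ?thesis by simp
qed

lemma sublinear_lower:
  assumes "sublinear q" shows "- q (- x) \<le> q x"
proof -
  have "q (x + - x) \<le> q x + q (- x)" using assms unfolding sublinear_def by blast
  then show ?thesis using sublinear_zero[OF assms] by simp
qed

text \<open>This is the largest sublinear functional below \<open>q\<close> whose value at \<open>- y\<close> is \<open>- q y\<close>.\<close>

definition linearize_along :: "('z::real_vector \<Rightarrow> real) \<Rightarrow> 'z \<Rightarrow> 'z \<Rightarrow> real" where
  "linearize_along q y x = (INF t\<in>{0..}. q (x + t *\<^sub>R y) - t * q y)"

lemma linearize_along_upper:
  assumes q: "sublinear q" and t: "t \<ge> 0"
  shows "linearize_along q y x \<le> q (x + t *\<^sub>R y) - t * q y"
  unfolding linearize_along_def
proof (rule cINF_lower)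
  have "- q (- x) \<le> q (x + s *\<^sub>R y) - s * q y" if s: "s \<ge> 0" for s
  proof (cases "s = 0")
    case True
    then show ?thesis using sublinear_lower[OF q] by simp
  next
    case False
    then have s': "s > 0" using s by simp
    have "y = (1/s) *\<^sub>R (s *\<^sub>R y)" using s' by simp
    then have "q y \<le> (1/s) * q (s *\<^sub>R y)"
      using q s' unfolding sublinear_def by (metis zero_less_divide_1_iff)
    then have "s * q y \<le> q (s *\<^sub>R y)" using s' by (simp add: field_simps)
    also have "q (s *\<^sub>R y) \<le> q (x + s *\<^sub>R y) + q (- x)"
    proof -
      have "q ((x + s *\<^sub>R y) + - x) \<le> q (x + s *\<^sub>R y) + q (- x)"
        using q unfolding sublinear_def by blast
      then show ?thesis by simp
    qed
    finally show ?thesis by simp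
  qed
  then show "bdd_below ((\<lambda>t. q (x + t *\<^sub>R y) - t * q y) ` {0..})"
    by (intro bdd_belowI2) auto
qed (use t in auto)

lemma linearize_along_greatest:
  assumes "\<And>t. t \<ge> 0 \<Longrightarrow> b \<le> q (x + t *\<^sub>R y) - t * q y"
  shows "b \<le> linearize_along q y x"
  unfolding linearize_along_def by (rule cINF_greatest) (use assms in auto)

lemma linearize_along_le:
  assumes "sublinear q" shows "linearize_along q y x \<le> q x"
  using linearize_along_upper[OF assms, of 0 y x] by simp

lemma sublinear_linearize_along:
  assumes q: "sublinear q" shows "sublinear (linearize_along q y)"
proof -
  let ?r = "linearize_along q y"
  have sub: "?r (a + b) \<le> ?r a + ?r b" for a b
  proof -
    have *: "?r (a + b) \<le> (q (a + t *\<^sub>R y) - t * q y) + (q (b + s *\<^sub>R y) - s * q y)"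
      if "t \<ge> 0" "s \<ge> 0" for t s
    proof -
      have "?r (a + b) \<le> q (a + b + (t + s) *\<^sub>R y) - (t + s) * q y"
        using that by (intro linearize_along_upper[OF q]) simp
      moreover have "a + b + (t + s) *\<^sub>R y = (a + t *\<^sub>R y) + (b + s *\<^sub>R y)"
        by (simp add: algebra_simps)
      moreover have "q ((a + t *\<^sub>R y) + (b + s *\<^sub>R y)) \<le> q (a + t *\<^sub>R y) + q (b + s *\<^sub>R y)"
        using q unfolding sublinear_def by blast
      ultimately show ?thesis by (simp add: algebra_simps)
    qed
    have "?r (a + b) - (q (a + t *\<^sub>R y) - t * q y) \<le> ?r b" if "t \<ge> 0" for t
      by (rule linearize_along_greatest) (use *[OF that] in \<open>simp add: algebra_simps\<close>)
    then have "?r (a + b) - ?r b \<le> ?r a"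
      by (intro linearize_along_greatest) (simp add: algebra_simps)
    then show ?thesis by simp
  qed
  have hom: "?r (c *\<^sub>R a) \<le> c * ?r a" if c: "c > 0" for c a
  proof -
    have "?r (c *\<^sub>R a) / c \<le> q (a + t *\<^sub>R y) - t * q y" if t: "t \<ge> 0" for t
    proof -
      have "?r (c *\<^sub>R a) \<le> q (c *\<^sub>R a + (c * t) *\<^sub>R y) - (c * t) * q y"
        using c t by (intro linearize_along_upper[OF q]) simp
      also have "c *\<^sub>R a + (c * t) *\<^sub>R y = c *\<^sub>R (a + t *\<^sub>R y)" by (simp add: algebra_simps)
      also have "q (c *\<^sub>R (a + t *\<^sub>R y)) \<le> c * q (a + t *\<^sub>R y)"
        using q c unfolding sublinear_def by blast
      finally show ?thesis using c by (simp add: field_simps)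
    qed
    then have "?r (c *\<^sub>R a) / c \<le> ?r a" by (rule linearize_along_greatest)
    then show ?thesis using c by (simp add: field_simps)
  qed
  show ?thesis unfolding sublinear_def using sub hom by blast
qed

text \<open>The infimum of a chain is subadditive because the smaller of two of its members bounds both
  terms. It is finite because \<open>q x\<close> is at least \<open>- p (- x)\<close> throughout.\<close>

lemma sublinear_chain_inf:
  assumes "C \<noteq> {}" and C: "C \<subseteq> {q. sublinear q \<and> (\<forall>x. q x \<le> p x)}"
    and chain: "\<forall>a\<in>C. \<forall>b\<in>C. (\<forall>x. a x \<le> b x) \<or> (\<forall>x. b x \<le> a x)"
  shows "sublinear (\<lambda>x. INF q\<in>C. q x)" and "\<forall>q\<in>C. \<forall>x. (INF q\<in>C. q x) \<le> q x"
proof -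
  have sub: "sublinear q" and le: "q x \<le> p x" if "q \<in> C" for q x
    using C that by auto
  have low: "(INF q\<in>C. q x) \<le> q x" if "q \<in> C" for q x
  proof (rule cINF_lower[OF _ that])
    have "- p (- x) \<le> q x" if "q \<in> C" for q
      using sublinear_lower[OF sub[OF that], of x] le[OF that, of "- x"] by linarith
    then show "bdd_below ((\<lambda>q. q x) ` C)" by (intro bdd_belowI2)
  qed
  then show "\<forall>q\<in>C. \<forall>x. (INF q\<in>C. q x) \<le> q x" by simp
  let ?u = "\<lambda>x. INF q\<in>C. q x"
  have great: "b \<le> ?u x" if "\<And>q. q \<in> C \<Longrightarrow> b \<le> q x" for b x
    by (rule cINF_greatest[OF \<open>C \<noteq> {}\<close>]) (rule that)
  have *: "?u (x + y) \<le> a x + b y" if ab: "a \<in> C" "b \<in> C" for x y a b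
  proof -
    obtain m where m: "m \<in> C" "m x \<le> a x" "m y \<le> b y"
      using chain[rule_format, OF ab] ab by (metis order_refl)
    have "?u (x + y) \<le> m (x + y)" by (rule low[OF m(1)])
    also have "\<dots> \<le> m x + m y" using sub[OF m(1)] unfolding sublinear_def by blast
    finally show ?thesis using m by linarith
  qed
  have "?u (x + y) \<le> ?u x + ?u y" for x y
  proof -
    have "?u (x + y) - a x \<le> ?u y" if "a \<in> C" for a
      by (rule great) (use *[OF that] in \<open>simp add: algebra_simps\<close>)
    then have "?u (x + y) - ?u y \<le> ?u x"
      by (intro great) (simp add: algebra_simps)
    then show ?thesis by simp
  qed
  moreover have "?u (c *\<^sub>R x) \<le> c * ?u x" if c: "c > 0" for c x
  proof -
    have "?u (c *\<^sub>R x) / c \<le> q x" if "q \<in> C" for q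
    proof -
      have "?u (c *\<^sub>R x) \<le> q (c *\<^sub>R x)" by (rule low[OF that])
      also have "\<dots> \<le> c * q x" using sub[OF that] c unfolding sublinear_def by blast
      finally show ?thesis using c by (simp add: field_simps)
    qed
    then have "?u (c *\<^sub>R x) / c \<le> ?u x" by (rule great)
    then show ?thesis using c by (simp add: field_simps)
  qed
  ultimately show "sublinear ?u" unfolding sublinear_def by blast
qed

text \<open>A minimal sublinear functional is linear: linearizing it along any vector \<open>y\<close> cannot make it
  smaller, and this forces additivity in the direction \<open>y\<close>.\<close>

lemma minimal_sublinear_linear:
  assumes m: "sublinear m"
    and minimal: "\<And>q. sublinear q \<Longrightarrow> (\<And>x. q x \<le> m x) \<Longrightarrow> q = m"
  shows "linear m"
proof -
  have add: "m (x + y) = m x + m y" for x y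
  proof (rule antisym)
    show "m (x + y) \<le> m x + m y" using m unfolding sublinear_def by blast
    have "linearize_along m y = m"
      using minimal sublinear_linearize_along[OF m] linearize_along_le[OF m] by blast
    then show "m x + m y \<le> m (x + y)"
      using linearize_along_upper[OF m, of 1 y x] by simp
  qed
  have neg: "m (- x) = - m x" for x
    using add[of x "- x"] sublinear_zero[OF m] by simp
  have pos: "m (c *\<^sub>R x) = c * m x" if c: "c > 0" for c x
  proof (rule antisym)
    show "m (c *\<^sub>R x) \<le> c * m x" using m c unfolding sublinear_def by blast
    have "m (c *\<^sub>R (- x)) \<le> c * m (- x)" using m c unfolding sublinear_def by blast
    then show "c * m x \<le> m (c *\<^sub>R x)" using neg[of "c *\<^sub>R x"] neg[of x] by simp
  qed
  have "m (c *\<^sub>R x) = c * m x" for c x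
  proof (cases c "0::real" rule: linorder_cases)
    case less
    then show ?thesis using pos[of "- c" x] neg[of "c *\<^sub>R x"] by simp
  qed (use pos sublinear_zero[OF m] in auto)
  with add show ?thesis by (intro linearI) auto
qed

text \<open>The Hahn--Banach theorem, obtained from Zorn's lemma by minimizing the sublinear functional
  instead of extending a linear one.\<close>

theorem sublinear_above_linear:
  assumes p: "sublinear p"
  obtains f where "linear f" "\<And>x. f x \<le> p x"
proof -
  let ?A = "{q. sublinear q \<and> (\<forall>x. q x \<le> p x)}"
  let ?P = "\<lambda>a b :: 'a \<Rightarrow> real. \<forall>x. b x \<le> a x"
  have "\<exists>m\<in>?A. \<forall>a\<in>?A. ?P m a \<longrightarrow> a = m"
  proof (rule predicate_Zorn)
    show "partial_order_on ?A (relation_of ?P ?A)"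
      by (rule partial_order_on_relation_ofI) (auto intro: order_trans intro!: ext antisym)
    fix C assume C: "C \<in> Chains (relation_of ?P ?A)"
    show "\<exists>u\<in>?A. \<forall>a\<in>C. ?P a u"
    proof (cases "C = {}")
      case True
      then show ?thesis using p by auto
    next
      case False
      have chain: "\<forall>a\<in>C. \<forall>b\<in>C. (\<forall>x. a x \<le> b x) \<or> (\<forall>x. b x \<le> a x)"
        using C unfolding Chains_def relation_of_def by auto
      note inf = sublinear_chain_inf[OF False Chains_relation_of[OF C] chain]
      obtain q0 where q0: "q0 \<in> C" using False by blast
      have "(INF q\<in>C. q x) \<le> p x" for x
        using inf(2) q0 Chains_relation_of[OF C] by (blast intro: order_trans)
      then have "(\<lambda>x. INF q\<in>C. q x) \<in> ?A" using inf(1) by simp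
      then show ?thesis by (rule bexI[rotated]) (use inf(2) in blast)
    qed
  qed
  then obtain m where m: "sublinear m" "\<And>x. m x \<le> p x"
    and minimal: "\<And>a. sublinear a \<Longrightarrow> (\<And>x. a x \<le> p x) \<Longrightarrow> (\<And>x. a x \<le> m x) \<Longrightarrow> a = m"
    by auto
  have "linear m"
    by (rule minimal_sublinear_linear[OF m(1)]) (meson m(2) minimal order_trans)
  then show thesis using that m(2) by blast
qed

text \<open>Linearizing the norm along \<open>z\<close> gives \<open>- norm z\<close> at \<open>- z\<close>, so every linear functional below the
  result takes at least the value \<open>norm z\<close> at \<open>z\<close>.\<close>

lemma norming_functional:
  fixes z :: "'z::real_normed_vector"
  obtains f :: "'z dual" where "norm f \<le> 1" "blinfun_apply f z = norm z"
proof -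
  have n: "sublinear (norm :: 'z \<Rightarrow> real)"
    unfolding sublinear_def by (simp add: norm_triangle_ineq)
  obtain g where g: "linear g" "\<And>x. g x \<le> linearize_along norm z x"
    using sublinear_above_linear[OF sublinear_linearize_along[OF n]] by blast
  have le: "g x \<le> norm x" for x
    using g(2) linearize_along_le[OF n] order_trans by blast
  have abs: "\<bar>g x\<bar> \<le> norm x" for x
    using le[of x] le[of "- x"] linear_neg[OF g(1), of x] by (simp add: abs_le_iff)
  have bl: "bounded_linear g"
    by (rule bounded_linear_intro[where K = 1])
       (use linear_add[OF g(1)] linear_scale[OF g(1)] abs in auto)
  have "g (- z) \<le> - norm z"
    using g(2)[of "- z"] linearize_along_upper[OF n, of 1 z "- z"] by simp
  then have "g z = norm z" using le[of z] linear_neg[OF g(1), of z] by simp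
  moreover have "norm (Blinfun g) \<le> 1"
    by (rule norm_blinfun_bound) (use abs in \<open>auto simp: bounded_linear_Blinfun_apply[OF bl]\<close>)
  ultimately show thesis
    using that[of "Blinfun g"] by (simp add: bounded_linear_Blinfun_apply[OF bl])
qed

section \<open>The weak-star topology of a dual ball\<close>

abbreviation dual_ball_topology :: "'z::real_normed_vector dual topology" where
  "dual_ball_topology \<equiv> subtopology weak_star_topology (cball 0 1)"

lemma topspace_weak_star_topology [simp]: "topspace weak_star_topology = UNIV"
  by (simp add: weak_star_topology_def topspace_pullback_topology)

lemma topspace_weak_topology [simp]: "topspace weak_topology = UNIV"
  by (simp add: weak_topology_def topspace_pullback_topology)

lemma continuous_map_weak_star_iff:
  "continuous_map T weak_star_topology g \<longleftrightarrow>
     (\<forall>z. continuous_map T euclideanreal (\<lambda>t. blinfun_apply (g t) z))"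
proof -
  have "continuous_map weak_star_topology euclidean ((\<lambda>h. h) \<circ> blinfun_apply)"
    unfolding weak_star_topology_def by (rule continuous_map_pullback) simp
  then have "continuous_map T euclidean (blinfun_apply \<circ> g)"
    if "continuous_map T weak_star_topology g"
    using continuous_map_compose[OF that] by (simp add: o_def)
  moreover have "continuous_map T weak_star_topology g"
    if "continuous_map T euclidean (blinfun_apply \<circ> g)"
    unfolding weak_star_topology_def by (rule continuous_map_pullback'[OF that]) simp
  ultimately have "continuous_map T weak_star_topology g \<longleftrightarrow> continuous_map T euclidean (blinfun_apply \<circ> g)"
    by blast
  also have "\<dots> \<longleftrightarrow> (\<forall>z. continuous_map T euclideanreal (\<lambda>t. blinfun_apply (g t) z))"
    by (simp add: euclidean_product_topology[symmetric] continuous_map_componentwise_UNIV)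
  finally show ?thesis .
qed

lemma continuous_map_weak_star_eval:
  "continuous_map weak_star_topology euclideanreal (\<lambda>f. blinfun_apply f z)"
  using continuous_map_weak_star_iff[of weak_star_topology "\<lambda>f. f"] by auto

lemma compactin_pullback_topology:
  assumes "compactin T (f ` S)" shows "compactin (pullback_topology UNIV f T) S"
  unfolding compactin_def
proof (intro conjI allI impI)
  show "S \<subseteq> topspace (pullback_topology UNIV f T)"
    using compactin_subset_topspace[OF assms] by (auto simp: topspace_pullback_topology)
  fix \<U> assume \<U>: "(\<forall>U\<in>\<U>. openin (pullback_topology UNIV f T) U) \<and> S \<subseteq> \<Union> \<U>"
  then have "\<forall>U\<in>\<U>. \<exists>V. openin T V \<and> U = f -` V"
    by (simp add: openin_pullback_topology)
  then obtain V where V: "\<And>U. U \<in> \<U> \<Longrightarrow> openin T (V U) \<and> U = f -` V U" by metis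
  have "f ` S \<subseteq> \<Union> (V ` \<U>)" using \<U> V by blast
  moreover have "openin T W" if "W \<in> V ` \<U>" for W using that V by auto
  ultimately obtain \<F> where \<F>: "finite \<F>" "\<F> \<subseteq> V ` \<U>" "f ` S \<subseteq> \<Union> \<F>"
    by (metis compactinD[OF assms])
  obtain \<G> where \<G>: "\<G> \<subseteq> \<U>" "finite \<G>" "\<F> = V ` \<G>"
    using finite_subset_image[OF \<F>(1,2)] by auto
  have "S \<subseteq> \<Union> \<G>"
  proof
    fix s assume "s \<in> S"
    then obtain U where "U \<in> \<G>" "f s \<in> V U" using \<F>(3) \<G>(3) by blast
    then show "s \<in> \<Union> \<G>" using V \<G>(1) by blast
  qed
  then show "\<exists>\<F>. finite \<F> \<and> \<F> \<subseteq> \<U> \<and> S \<subseteq> \<Union> \<F>" using \<G> by blast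
qed

text \<open>The Banach--Alaoglu theorem: the evaluations identify the ball with a closed subset of a
  product of compact intervals.\<close>

theorem compactin_weak_star_cball:
  "compactin weak_star_topology (cball (0 :: 'z::real_normed_vector dual) 1)"
proof -
  let ?box = "PiE UNIV (\<lambda>z::'z. {- norm z..norm z})"
  let ?L = "{f :: 'z \<Rightarrow> real. (\<forall>x y. f (x + y) = f x + f y) \<and> (\<forall>c x. f (c *\<^sub>R x) = c * f x)}"
  have "compactin (product_topology (\<lambda>_::'z. euclideanreal) UNIV) ?box"
    by (subst compactin_PiE) auto
  then have box: "compactin euclidean ?box" by (simp add: euclidean_product_topology)
  have "closed ?L"
    by (intro closed_Collect_conj closed_Collect_all closed_Collect_eq continuous_intros
        continuous_on_product_coordinates)
  then have "compact (?L \<inter> ?box)" using box by (intro closed_Int_compact) simp_all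
  moreover have "blinfun_apply ` cball (0 :: 'z dual) 1 = ?L \<inter> ?box"
  proof (intro set_eqI iffI)
    fix h assume "h \<in> blinfun_apply ` cball (0 :: 'z dual) 1"
    then obtain f :: "'z dual" where f: "norm f \<le> 1" "h = blinfun_apply f" by auto
    have "\<bar>h z\<bar> \<le> norm z" for z
      using norm_blinfun[of f z] mult_right_mono[OF f(1) norm_ge_zero[of z]] f(2) by simp
    then show "h \<in> ?L \<inter> ?box"
      using f(2) by (auto simp: blinfun.bilinear_simps abs_le_iff minus_le_iff)
  next
    fix h assume h: "h \<in> ?L \<inter> ?box"
    then have abs: "\<bar>h z\<bar> \<le> norm z" for z by (force simp: abs_le_iff minus_le_iff)
    have bl: "bounded_linear h"
      by (rule bounded_linear_intro[where K = 1]) (use h abs in auto)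
    have "norm (Blinfun h) \<le> 1"
      by (rule norm_blinfun_bound) (use abs in \<open>auto simp: bounded_linear_Blinfun_apply[OF bl]\<close>)
    then show "h \<in> blinfun_apply ` cball (0 :: 'z dual) 1"
      by (intro image_eqI[of _ _ "Blinfun h"]) (auto simp: bounded_linear_Blinfun_apply[OF bl])
  qed
  ultimately show ?thesis
    unfolding weak_star_topology_def by (intro compactin_pullback_topology) simp
qed

lemma compact_space_dual_ball: "compact_space dual_ball_topology"
  by (rule compact_space_subtopology[OF compactin_weak_star_cball])

text \<open>If no point of a compact set satisfies all the equations \<open>\<phi> k t = c k\<close>, then finitely many of them
  already exclude every point, with a uniform margin. This takes the place of passing to
  convergent subnets.\<close>

lemma compact_uniform_separation:
  assumes N: "compactin T N"
    and cont: "\<And>k. k \<in> K \<Longrightarrow> continuous_map T euclideanreal (\<phi> k)"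
    and sep: "\<And>t. t \<in> N \<Longrightarrow> \<exists>k\<in>K. \<phi> k t \<noteq> c k"
  obtains A d where "finite A" "A \<subseteq> K" "d > 0" "\<And>t. t \<in> N \<Longrightarrow> \<exists>k\<in>A. d \<le> \<bar>\<phi> k t - c k\<bar>"
proof -
  define V where "V = (\<lambda>(k, d). {t \<in> topspace T. d < \<bar>\<phi> k t - c k\<bar>})"
  let ?I = "K \<times> {0::real<..}"
  have "openin T (V i)" if iI: "i \<in> ?I" for i
  proof -
    obtain k d where i: "i = (k, d)" "k \<in> K" using iI by blast
    have "continuous_map T euclideanreal (\<lambda>t. \<bar>\<phi> k t - c k\<bar>)"
      by (intro continuous_intros cont i)
    from openin_continuous_map_preimage[OF this, of "{d<..}"]
    show ?thesis by (simp add: V_def i)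
  qed
  moreover have "N \<subseteq> \<Union> (V ` ?I)"
  proof
    fix t assume t: "t \<in> N"
    then obtain k where k: "k \<in> K" "\<phi> k t \<noteq> c k" using sep by blast
    then have "t \<in> V (k, \<bar>\<phi> k t - c k\<bar> / 2)"
      using t compactin_subset_topspace[OF N] by (auto simp: V_def)
    moreover have "(k, \<bar>\<phi> k t - c k\<bar> / 2) \<in> ?I" using k by simp
    ultimately show "t \<in> \<Union> (V ` ?I)" by blast
  qed
  ultimately have "\<exists>\<F>. finite \<F> \<and> \<F> \<subseteq> V ` ?I \<and> N \<subseteq> \<Union> \<F>"
    by (intro compactinD[OF N]) auto
  then obtain B where B: "finite B" "B \<subseteq> ?I" "N \<subseteq> \<Union> (V ` B)"
    by (metis finite_subset_image)
  let ?d = "Min (insert 1 (snd ` B))"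
  show thesis
  proof (rule that[of "fst ` B" ?d])
    show "?d > 0" using B by (subst Min_gr_iff) auto
    fix t assume "t \<in> N"
    then obtain k d where kd: "(k, d) \<in> B" "d < \<bar>\<phi> k t - c k\<bar>"
      using B(3) by (force simp: V_def)
    have "?d \<le> d" using kd B(1) by (intro Min_le) force+
    then show "\<exists>k\<in>fst ` B. ?d \<le> \<bar>\<phi> k t - c k\<bar>" using kd by force
  qed (use B in auto)
qed

text \<open>Only the part of the ball outside \<open>U\<close> has to be separated from \<open>f\<close>, and it is compact.\<close>

lemma dual_ball_basic_neighbourhood:
  assumes "openin dual_ball_topology U" "f \<in> U"
  obtains A d where "finite A" "d > 0"
    "\<And>g. norm g \<le> 1 \<Longrightarrow> (\<And>z. z \<in> A \<Longrightarrow> \<bar>blinfun_apply g z - blinfun_apply f z\<bar> < d) \<Longrightarrow> g \<in> U"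
proof -
  have "closedin dual_ball_topology (cball 0 1 - U)"
    using closedin_diff[OF closedin_topspace assms(1)] by simp
  then have "compactin dual_ball_topology (cball 0 1 - U)"
    by (rule closedin_compact_space[OF compact_space_dual_ball])
  moreover have "continuous_map dual_ball_topology euclideanreal (\<lambda>g. blinfun_apply g z)" for z :: 'a
    by (rule continuous_map_from_subtopology[OF continuous_map_weak_star_eval])
  moreover have "\<exists>z\<in>UNIV. blinfun_apply g z \<noteq> blinfun_apply f z" if "g \<in> cball 0 1 - U" for g
    using that assms(2) blinfun_eqI[of g f] by auto
  ultimately obtain A d where A: "finite A" "d > 0"
    "\<And>g. g \<in> cball 0 1 - U \<Longrightarrow> \<exists>z\<in>A. d \<le> \<bar>blinfun_apply g z - blinfun_apply f z\<bar>"
    by (rule compact_uniform_separation[where \<phi> = "\<lambda>z g. blinfun_apply g z" and c = "blinfun_apply f"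
          and K = UNIV]) auto
  show thesis
  proof (rule that[OF A(1,2)])
    fix g :: "'a dual"
    assume g: "norm g \<le> 1" "\<And>z. z \<in> A \<Longrightarrow> \<bar>blinfun_apply g z - blinfun_apply f z\<bar> < d"
    show "g \<in> U" using A(3)[of g] g by force
  qed
qed

lemma topcontinuous_at_real_iff:
  "topcontinuous_at T euclideanreal h a \<longleftrightarrow>
     a \<in> topspace T \<and> (\<forall>e>0. \<exists>U. openin T U \<and> a \<in> U \<and> (\<forall>t\<in>U. \<bar>h t - h a\<bar> < e))"
  unfolding topcontinuous_at_def
proof (intro conj_cong refl iffI allI impI; (elim conjE)?)
  fix e :: real
  assume *: "\<forall>V. openin euclideanreal V \<and> h a \<in> V \<longrightarrow> (\<exists>U. openin T U \<and> a \<in> U \<and> (\<forall>y\<in>U. h y \<in> V))" "e > 0"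
  from *(1)[rule_format, of "ball (h a) e"] *(2)
  show "\<exists>U. openin T U \<and> a \<in> U \<and> (\<forall>t\<in>U. \<bar>h t - h a\<bar> < e)"
    by (simp add: dist_real_def abs_minus_commute)
next
  assume *: "\<forall>e>0. \<exists>U. openin T U \<and> a \<in> U \<and> (\<forall>t\<in>U. \<bar>h t - h a\<bar> < e)"
  show "h \<in> topspace T \<rightarrow> topspace euclideanreal \<and>
    (\<forall>V. openin euclideanreal V \<and> h a \<in> V \<longrightarrow> (\<exists>U. openin T U \<and> a \<in> U \<and> (\<forall>y\<in>U. h y \<in> V)))"
  proof (intro conjI allI impI; (elim conjE)?)
    fix V assume V: "openin euclideanreal V" "h a \<in> V"
    then obtain e where "e > 0" "\<forall>y. dist y (h a) < e \<longrightarrow> y \<in> V"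
      by (auto simp: open_dist)
    then show "\<exists>U. openin T U \<and> a \<in> U \<and> (\<forall>y\<in>U. h y \<in> V)"
      using * by (metis dist_real_def)
  qed auto
qed

text \<open>Continuity into the weak topology is tested by the functionals one at a time.\<close>

lemma weak_star_weak_pc_iff:
  fixes f :: "'z::real_normed_vector dual"
  shows "weak_star_weak_pc f \<longleftrightarrow> norm f \<le> 1 \<and>
     (\<forall>\<Phi> :: 'z dual dual. topcontinuous_at dual_ball_topology euclideanreal (blinfun_apply \<Phi>) f)"
    (is "?L \<longleftrightarrow> ?R")
proof
  assume ?L
  then have f: "norm f \<le> 1" and
    pc: "\<And>V. openin (subtopology weak_topology (cball 0 1)) V \<Longrightarrow> f \<in> V \<Longrightarrow>
           \<exists>U. openin dual_ball_topology U \<and> f \<in> U \<and> (\<forall>y\<in>U. y \<in> V)"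
    by (auto simp: weak_star_weak_pc_def topcontinuous_at_def)
  show ?R
  proof (intro conjI allI f)
    fix \<Phi> :: "'z dual dual"
    have cont: "continuous_map weak_topology euclideanreal (blinfun_apply \<Phi>)"
    proof -
      have "continuous_map euclidean euclideanreal (\<lambda>h :: 'z dual dual \<Rightarrow> real. h \<Phi>)"
        by (simp add: continuous_on_product_coordinates)
      then have "continuous_map weak_topology euclideanreal ((\<lambda>h. h \<Phi>) \<circ> (\<lambda>z (F :: 'z dual dual). blinfun_apply F z))"
        unfolding weak_topology_def by (rule continuous_map_pullback)
      then show ?thesis by (simp add: o_def)
    qed
    show "topcontinuous_at dual_ball_topology euclideanreal (blinfun_apply \<Phi>) f"
      unfolding topcontinuous_at_def
    proof (intro conjI allI impI)
      fix V assume V: "openin euclideanreal V \<and> \<Phi> f \<in> V"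
      then have "openin (subtopology weak_topology (cball 0 1)) (cball 0 1 \<inter> blinfun_apply \<Phi> -` V)"
        using openin_continuous_map_preimage[OF cont, of V]
        by (auto simp: openin_subtopology vimage_def)
      from pc[OF this] V f
      show "\<exists>U. openin dual_ball_topology U \<and> f \<in> U \<and> (\<forall>y\<in>U. \<Phi> y \<in> V)" by auto
    qed (use f in auto)
  qed
next
  assume R: ?R
  show ?L
    unfolding weak_star_weak_pc_def topcontinuous_at_def
  proof (intro conjI allI impI)
    fix V assume V: "openin (subtopology weak_topology (cball 0 1)) V \<and> f \<in> V"
    then obtain W :: "('z dual dual \<Rightarrow> real) set"
      where W: "open W" "V = (\<lambda>z F. blinfun_apply F z) -` W \<inter> cball 0 1"
      by (auto simp: openin_subtopology weak_topology_def openin_pullback_topology)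
    let ?e = "\<lambda>g (F :: 'z dual dual). blinfun_apply F g"
    have "openin (product_topology (\<lambda>_. euclideanreal) UNIV) W" "?e f \<in> W"
      using W V by (auto simp: euclidean_product_topology)
    then obtain X where X: "?e f \<in> PiE UNIV X" "\<And>i. open (X i)" "finite {i. X i \<noteq> UNIV}" "PiE UNIV X \<subseteq> W"
      by (auto dest!: product_topology_open_contains_basis)
    let ?J = "{i. X i \<noteq> UNIV}"
    have "\<exists>U. openin dual_ball_topology U \<and> f \<in> U \<and> (\<forall>y\<in>U. blinfun_apply \<Phi> y \<in> X \<Phi>)" for \<Phi>
      using R X(1,2) unfolding topcontinuous_at_def by (auto simp: PiE_iff)
    then obtain U where U: "\<And>\<Phi>. openin dual_ball_topology (U \<Phi>) \<and> f \<in> U \<Phi> \<and> (\<forall>y\<in>U \<Phi>. blinfun_apply \<Phi> y \<in> X \<Phi>)"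
      by metis
    let ?U = "(\<Inter>i\<in>?J. U i) \<inter> topspace dual_ball_topology"
    have "openin dual_ball_topology ?U"
      using X(3) U by (intro openin_INT) blast+
    moreover have "f \<in> ?U" using U R by auto
    moreover have "y \<in> V" if "y \<in> ?U" for y
    proof -
      have "blinfun_apply \<Phi> y \<in> X \<Phi>" for \<Phi>
        using that U[of \<Phi>] by (cases "X \<Phi> = UNIV") auto
      then have "?e y \<in> PiE UNIV X" by (simp add: PiE_iff)
      then show ?thesis using X(4) W(2) that by auto
    qed
    ultimately show "\<exists>U. openin dual_ball_topology U \<and> f \<in> U \<and> (\<forall>y\<in>U. y \<in> V)"
      by (intro exI[of _ ?U]) simp
  qed (use R in auto)
qed

text \<open>If \<open>b\<close> tends weak-star to \<open>a\<close>, then \<open>G b\<close> tends weak-star, hence weakly, to \<open>G a\<close>. Since every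
  functional \<open>F\<close> factors through \<open>G\<close>, also \<open>F b\<close> tends to \<open>F a\<close>.\<close>

lemma weak_star_weak_pc_transfer:
  fixes G :: "'a::real_normed_vector dual \<Rightarrow> 'b::real_normed_vector dual"
  assumes pc: "weak_star_weak_pc (G a)" and a: "norm a \<le> 1"
    and ball: "\<And>b. norm b \<le> 1 \<Longrightarrow> norm (G b) \<le> 1"
    and cont: "\<And>z. topcontinuous_at dual_ball_topology euclideanreal (\<lambda>b. blinfun_apply (G b) z) a"
    and factor: "\<And>F :: 'a dual dual. \<exists>\<Phi> :: 'b dual dual. \<forall>b. blinfun_apply F b = blinfun_apply \<Phi> (G b)"
  shows "weak_star_weak_pc a"
  unfolding weak_star_weak_pc_iff topcontinuous_at_def
proof (intro conjI allI impI a)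
  fix F :: "'a dual dual" and V :: "real set"
  assume V: "openin euclideanreal V \<and> F a \<in> V"
  obtain \<Phi> :: "'b dual dual" where \<Phi>: "\<And>b. F b = \<Phi> (G b)" using factor by blast
  have "topcontinuous_at dual_ball_topology euclideanreal (blinfun_apply \<Phi>) (G a)"
    using pc weak_star_weak_pc_iff by blast
  then obtain U where U: "openin dual_ball_topology U" "G a \<in> U" "\<forall>g\<in>U. \<Phi> g \<in> V"
    using V \<Phi> unfolding topcontinuous_at_def by metis
  from U(1,2) obtain A d where A: "finite A" "d > 0"
    "\<And>g. norm g \<le> 1 \<Longrightarrow> (\<And>z. z \<in> A \<Longrightarrow> \<bar>blinfun_apply g z - blinfun_apply (G a) z\<bar> < d) \<Longrightarrow> g \<in> U"
    by (rule dual_ball_basic_neighbourhood) blast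
  have "\<exists>W. openin dual_ball_topology W \<and> a \<in> W \<and> (\<forall>b\<in>W. \<bar>blinfun_apply (G b) z - blinfun_apply (G a) z\<bar> < d)" for z
    using cont[of z] A(2) unfolding topcontinuous_at_real_iff by blast
  then obtain W where W: "\<And>z. openin dual_ball_topology (W z) \<and> a \<in> W z \<and> (\<forall>b\<in>W z. \<bar>blinfun_apply (G b) z - blinfun_apply (G a) z\<bar> < d)"
    by metis
  let ?W = "(\<Inter>z\<in>A. W z) \<inter> topspace dual_ball_topology"
  have "openin dual_ball_topology ?W"
    using A(1) W by (intro openin_INT) blast+
  moreover have "a \<in> ?W" using W a by auto
  moreover have "F b \<in> V" if "b \<in> ?W" for b
  proof -
    have "G b \<in> U" using that W by (intro A(3) ball) auto
    then show ?thesis using U(3) \<Phi> by simp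
  qed
  ultimately show "\<exists>U. openin dual_ball_topology U \<and> a \<in> U \<and> (\<forall>y\<in>U. F y \<in> V)" by blast
qed (use a in auto)

section \<open>Norming sets, density and extreme points\<close>

text \<open>Suppose the distances to \<open>\<tau>\<close>, measured by the sum of squares over \<open>A\<close>, were bounded below
  on \<open>C\<close>. Take an almost minimizer \<open>c\<close>, and let the vector \<open>w\<close> represent the direction in which the
  distance decreases fastest at \<open>c\<close>. By convexity no element of \<open>C\<close> exceeds \<open>c\<close> at \<open>w\<close> noticeably, so \<open>c w\<close> is almost \<open>norm w\<close> because
  \<open>C\<close> is norming; but \<open>\<tau> w\<close>, which is at most \<open>norm w\<close>, exceeds \<open>c w\<close> by the squared distance.\<close>

lemma norming_convex_approximates:
  fixes C :: "'z::real_normed_vector dual set"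
  assumes conv: "convex C" and C: "C \<subseteq> cball 0 1"
    and norming: "\<And>z \<eta>. \<eta> > 0 \<Longrightarrow> \<exists>c\<in>C. norm z - \<eta> < blinfun_apply c z"
    and \<tau>: "norm \<tau> \<le> 1" and A: "finite A" and e: "e > 0"
  shows "\<exists>c\<in>C. \<forall>z\<in>A. \<bar>blinfun_apply c z - blinfun_apply \<tau> z\<bar> < e"
proof (rule ccontr)
  assume far: "\<not> ?thesis"
  define q where "q c = (\<Sum>z\<in>A. (blinfun_apply c z - blinfun_apply \<tau> z)\<^sup>2)" for c
  define N where "N = (\<Sum>z\<in>A. (2 * norm z)\<^sup>2)"
  have N: "N \<ge> 0" unfolding N_def by (intro sum_nonneg) auto
  have abs: "\<bar>blinfun_apply c z\<bar> \<le> norm z" if "norm c \<le> 1" for c :: "'z dual" and z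
    using norm_blinfun[of c z] mult_right_mono[OF that norm_ge_zero[of z]] by simp
  have q_low: "e\<^sup>2 \<le> q c" if c: "c \<in> C" for c
  proof -
    obtain z where z: "z \<in> A" "e \<le> \<bar>blinfun_apply c z - blinfun_apply \<tau> z\<bar>"
      using far c by (auto simp: not_less)
    have "e\<^sup>2 \<le> \<bar>blinfun_apply c z - blinfun_apply \<tau> z\<bar>\<^sup>2"
      using z e by (intro power_mono) auto
    also have "\<dots> \<le> q c" unfolding q_def power2_abs
      using z A by (intro member_le_sum[of z A "\<lambda>z. (blinfun_apply c z - blinfun_apply \<tau> z)\<^sup>2"]) auto
    finally show ?thesis .
  qed
  have ne: "C \<noteq> {}" using norming[of 1 0] by auto
  have bdd: "bdd_below (q ` C)" using q_low by (intro bdd_belowI2)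
  define d where "d = (INF c\<in>C. q c)"
  have d_low: "d \<le> q c" if "c \<in> C" for c
    unfolding d_def by (rule cINF_lower[OF bdd that])
  have d_pos: "e\<^sup>2 \<le> d" unfolding d_def by (rule cINF_greatest[OF ne q_low])
  \<comment> \<open>Almost minimality up to \<open>t\<^sup>2\<close>, followed by a step of length \<open>t\<close> from \<open>c\<close> towards another point of \<open>C\<close>,
    gives first-order optimality up to an error of order \<open>t\<close>; this \<open>t\<close> makes the total error at most
    \<open>e\<^sup>2\<close>.\<close>
  define t where "t = min 1 (e\<^sup>2 / (2 + N))"
  have t: "0 < t" "t \<le> 1" using e N by (auto simp: t_def)
  have "t \<le> e\<^sup>2 / (2 + N)" unfolding t_def by simp
  then have tN: "t * (2 + N) \<le> e\<^sup>2" using N by (simp add: field_simps)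
  obtain c where c: "c \<in> C" "q c < d + t\<^sup>2"
  proof -
    have "(INF c\<in>C. q c) < d + t\<^sup>2" using t by (simp add: d_def)
    then show thesis using that cINF_less_iff[OF ne bdd] by auto
  qed
  define w where "w = (\<Sum>z\<in>A. (blinfun_apply \<tau> z - blinfun_apply c z) *\<^sub>R z)"
  have w: "blinfun_apply f w = (\<Sum>z\<in>A. (blinfun_apply \<tau> z - blinfun_apply c z) * blinfun_apply f z)" for f :: "'z dual"
    by (simp add: w_def blinfun.sum_right blinfun.scaleR_right)
  obtain c' where c': "c' \<in> C" "norm w - t < blinfun_apply c' w" using norming[OF t(1)] by blast
  have "(1 - t) *\<^sub>R c + t *\<^sub>R c' \<in> C"
    using convexD_alt[OF conv c(1) c'(1)] t by simp
  then have "d \<le> q ((1 - t) *\<^sub>R c + t *\<^sub>R c')" by (rule d_low)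
  also have "\<dots> = (\<Sum>z\<in>A. (blinfun_apply c z - blinfun_apply \<tau> z)\<^sup>2
       - 2 * t * ((blinfun_apply \<tau> z - blinfun_apply c z) * blinfun_apply c' z
                - (blinfun_apply \<tau> z - blinfun_apply c z) * blinfun_apply c z)
       + t\<^sup>2 * (blinfun_apply c' z - blinfun_apply c z)\<^sup>2)"
    unfolding q_def by (intro sum.cong refl) (simp add: blinfun.bilinear_simps power2_eq_square algebra_simps)
  also have "\<dots> = q c - 2 * t * (blinfun_apply c' w - blinfun_apply c w)
       + t\<^sup>2 * (\<Sum>z\<in>A. (blinfun_apply c' z - blinfun_apply c z)\<^sup>2)"
    by (simp add: q_def w sum.distrib sum_subtractf sum_distrib_left[symmetric])
  also have "(\<Sum>z\<in>A. (blinfun_apply c' z - blinfun_apply c z)\<^sup>2) \<le> N"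
    unfolding N_def
  proof (intro sum_mono)
    fix z
    have "\<bar>blinfun_apply c' z - blinfun_apply c z\<bar> \<le> 2 * norm z"
      using abs[of c' z] abs[of c z] c(1) c'(1) C by force
    then show "(blinfun_apply c' z - blinfun_apply c z)\<^sup>2 \<le> (2 * norm z)\<^sup>2"
      using power_mono[of "\<bar>blinfun_apply c' z - blinfun_apply c z\<bar>" "2 * norm z" 2] by simp
  qed
  finally have "d \<le> q c - 2 * t * (blinfun_apply c' w - blinfun_apply c w) + t\<^sup>2 * N"
    using t by (simp add: mult_left_mono)
  then have "2 * t * (blinfun_apply c' w - blinfun_apply c w) \<le> t\<^sup>2 * (1 + N)"
    using c(2) by (simp add: algebra_simps)
  then have "t * (2 * (blinfun_apply c' w - blinfun_apply c w)) \<le> t * (t * (1 + N))"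
    by (simp add: power2_eq_square algebra_simps)
  then have 1: "2 * (blinfun_apply c' w - blinfun_apply c w) \<le> t * (1 + N)"
    using t(1) by (simp only: mult_le_cancel_left_pos)
  have "e\<^sup>2 \<le> q c" by (rule q_low[OF c(1)])
  also have "q c = blinfun_apply \<tau> w - blinfun_apply c w"
    unfolding w q_def sum_subtractf[symmetric] by (intro sum.cong) (auto simp: power2_eq_square algebra_simps)
  also have "\<dots> \<le> norm w - blinfun_apply c w" using abs[OF \<tau>, of w] by simp
  finally have "e\<^sup>2 < blinfun_apply c' w - blinfun_apply c w + t" using c'(2) by simp
  then have "2 * e\<^sup>2 < t * (1 + N) + 2 * t" using 1 by simp
  then have "2 * e\<^sup>2 < t * (3 + N)" by (simp add: algebra_simps)
  moreover have "t * (3 + N) \<le> 2 * (t * (2 + N))" using t N by (simp add: algebra_simps)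
  ultimately show False using tN by simp
qed

lemma norming_convex_dense:
  fixes C :: "'z::real_normed_vector dual set"
  assumes "convex C" "C \<subseteq> cball 0 1"
    and "\<And>z \<eta>. \<eta> > 0 \<Longrightarrow> \<exists>c\<in>C. norm z - \<eta> < blinfun_apply c z"
    and U: "openin dual_ball_topology U" "\<tau> \<in> U"
  shows "C \<inter> U \<noteq> {}"
proof -
  have \<tau>: "norm \<tau> \<le> 1" using openin_subset[OF U(1)] U(2) by auto
  obtain A d where A: "finite A" "d > 0"
    "\<And>g. norm g \<le> 1 \<Longrightarrow> (\<And>z. z \<in> A \<Longrightarrow> \<bar>blinfun_apply g z - blinfun_apply \<tau> z\<bar> < d) \<Longrightarrow> g \<in> U"
    by (rule dual_ball_basic_neighbourhood[OF U]) blast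
  obtain c where c: "c \<in> C" "\<forall>z\<in>A. \<bar>blinfun_apply c z - blinfun_apply \<tau> z\<bar> < d"
    using norming_convex_approximates[OF assms(1-3) \<tau> A(1,2)] by blast
  then have "c \<in> U" using assms(2) by (intro A(3)) auto
  then show ?thesis using c(1) by blast
qed

lemma norming_convex_compact_eq_cball:
  fixes C :: "'z::real_normed_vector dual set"
  assumes "convex C" "C \<subseteq> cball 0 1"
    and "\<And>z \<eta>. \<eta> > 0 \<Longrightarrow> \<exists>c\<in>C. norm z - \<eta> < blinfun_apply c z"
    and comp: "compactin weak_star_topology C"
  shows "C = cball 0 1"
proof (rule antisym[OF assms(2)], rule subsetI, rule ccontr)
  fix \<tau> :: "'z dual" assume \<tau>: "\<tau> \<in> cball 0 1" "\<tau> \<notin> C"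
  have sep: "\<exists>z\<in>UNIV. blinfun_apply c z \<noteq> blinfun_apply \<tau> z" if "c \<in> C" for c
    using that \<tau>(2) blinfun_eqI[of c \<tau>] by auto
  obtain A d where A: "finite A" "d > 0"
    "\<And>c. c \<in> C \<Longrightarrow> \<exists>z\<in>A. d \<le> \<bar>blinfun_apply c z - blinfun_apply \<tau> z\<bar>"
    by (rule compact_uniform_separation[where \<phi> = "\<lambda>z c. blinfun_apply c z" and K = UNIV,
          OF comp continuous_map_weak_star_eval sep]) auto
  then show False
    using norming_convex_approximates[OF assms(1-3) _ A(1,2), of \<tau>] \<tau>(1) by force
qed

lemma convex_combine_scaled:
  assumes "convex S" "s \<in> S" "t \<in> S" "a \<ge> 0" "b \<ge> 0"
  obtains r where "r \<in> S" "a *\<^sub>R s + b *\<^sub>R t = (a + b) *\<^sub>R r"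
proof (cases "a + b = 0")
  case True
  then have "a = 0" "b = 0" using assms by auto
  then show thesis using that[OF assms(2)] by simp
next
  case False
  let ?r = "(a / (a + b)) *\<^sub>R s + (b / (a + b)) *\<^sub>R t"
  have "?r \<in> S"
    using assms False by (intro convexD) (auto simp: add_divide_distrib[symmetric])
  moreover have "a *\<^sub>R s + b *\<^sub>R t = (a + b) *\<^sub>R ?r"
    using False by (simp add: scaleR_add_right)
  ultimately show thesis by (rule that)
qed

lemma convex_hull_Un_explicit:
  assumes S: "convex S" "S \<noteq> {}" and T: "convex T" "T \<noteq> {}"
  shows "convex hull (S \<union> T) = (\<lambda>(u, s, t). (1 - u) *\<^sub>R s + u *\<^sub>R t) ` ({0..1::real} \<times> S \<times> T)"
    (is "_ = ?J")
proof (rule hull_unique)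
  obtain s0 t0 where "s0 \<in> S" "t0 \<in> T" using assms by blast
  then have "s \<in> ?J" if "s \<in> S" for s
    using that by (intro image_eqI[of _ _ "(0, s, t0)"]) auto
  moreover have "t \<in> ?J" if "t \<in> T" for t
    using that \<open>s0 \<in> S\<close> by (intro image_eqI[of _ _ "(1, s0, t)"]) auto
  ultimately show "S \<union> T \<subseteq> ?J" by blast
  show "?J \<subseteq> D" if D: "S \<union> T \<subseteq> D" "convex D" for D
    using D(1) by (auto intro!: convexD_alt[OF D(2)])
  show "convex ?J"
  proof (rule convexI)
    fix p q and a b :: real
    assume "p \<in> ?J" "q \<in> ?J" and ab: "0 \<le> a" "0 \<le> b" "a + b = 1"
    then obtain u s t v s' t'
      where p: "p = (1 - u) *\<^sub>R s + u *\<^sub>R t" "0 \<le> u" "u \<le> 1" "s \<in> S" "t \<in> T"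
        and q: "q = (1 - v) *\<^sub>R s' + v *\<^sub>R t'" "0 \<le> v" "v \<le> 1" "s' \<in> S" "t' \<in> T"
      by auto
    obtain x where x: "x \<in> S"
      "(a * (1 - u)) *\<^sub>R s + (b * (1 - v)) *\<^sub>R s' = (a * (1 - u) + b * (1 - v)) *\<^sub>R x"
      by (rule convex_combine_scaled[OF S(1) p(4) q(4), of "a * (1 - u)" "b * (1 - v)"])
         (use ab p q in auto)
    obtain y where y: "y \<in> T" "(a * u) *\<^sub>R t + (b * v) *\<^sub>R t' = (a * u + b * v) *\<^sub>R y"
      by (rule convex_combine_scaled[OF T(1) p(5) q(5), of "a * u" "b * v"])
         (use ab p q in auto)
    have one: "a * (1 - u) + b * (1 - v) = 1 - (a * u + b * v)"
      using ab(3) by (simp add: algebra_simps)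
    have "a *\<^sub>R p + b *\<^sub>R q = ((a * (1 - u)) *\<^sub>R s + (b * (1 - v)) *\<^sub>R s') + ((a * u) *\<^sub>R t + (b * v) *\<^sub>R t')"
      unfolding p(1) q(1) by (simp add: scaleR_add_right)
    also have "\<dots> = (1 - (a * u + b * v)) *\<^sub>R x + (a * u + b * v) *\<^sub>R y"
      unfolding x(2) y(2) one ..
    finally have eq: "a *\<^sub>R p + b *\<^sub>R q = \<dots>" .
    have "a * u + b * v \<le> a * 1 + b * 1"
      using ab p q by (intro add_mono mult_left_mono) auto
    then show "a *\<^sub>R p + b *\<^sub>R q \<in> ?J"
      using eq x(1) y(1) ab p q
      by (intro image_eqI[of _ _ "(a * u + b * v, x, y)"]) auto
  qed
qed

lemma compactin_convex_hull_Un: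
  fixes S T :: "'z::real_normed_vector dual set"
  assumes S: "convex S" "compactin weak_star_topology S"
    and T: "convex T" "compactin weak_star_topology T"
  shows "compactin weak_star_topology (convex hull (S \<union> T))"
proof (cases "S = {} \<or> T = {}")
  case True
  then show ?thesis using S T by (auto simp: convex_hull_eq[THEN iffD2])
next
  case False
  let ?Q = "prod_topology (top_of_set {0..1::real}) (prod_topology weak_star_topology weak_star_topology)"
  let ?j = "\<lambda>(u, s, t). (1 - u) *\<^sub>R s + u *\<^sub>R (t :: 'z dual)"
  have fst: "continuous_map ?Q euclideanreal (\<lambda>p. fst p)"
    using continuous_map_compose[OF continuous_map_fst continuous_map_into_fulltopology[OF continuous_map_id]]
    by (simp add: o_def)
  have s: "continuous_map ?Q euclideanreal (\<lambda>p. blinfun_apply (fst (snd p)) z)" for z :: 'z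
    using continuous_map_compose[OF continuous_map_compose[OF continuous_map_snd continuous_map_fst]
        continuous_map_weak_star_eval[of z]] by (simp add: o_def)
  have t: "continuous_map ?Q euclideanreal (\<lambda>p. blinfun_apply (snd (snd p)) z)" for z :: 'z
    using continuous_map_compose[OF continuous_map_compose[OF continuous_map_snd continuous_map_snd]
        continuous_map_weak_star_eval[of z]] by (simp add: o_def)
  have "continuous_map ?Q weak_star_topology ?j"
    unfolding continuous_map_weak_star_iff
    by (simp add: case_prod_beta blinfun.bilinear_simps) (intro allI continuous_intros fst s t)
  moreover have "compactin ?Q ({0..1} \<times> S \<times> T)"
    using S T by (simp add: compactin_Times compactin_subtopology)
  ultimately have "compactin weak_star_topology (?j ` ({0..1} \<times> S \<times> T))"
    by (rule image_compactin[rotated])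
  then show ?thesis using convex_hull_Un_explicit[of S T] S T False by simp
qed

lemma compactin_convex_hull_Union:
  assumes "finite \<H>"
    and "\<And>H. H \<in> \<H> \<Longrightarrow> convex H \<and> compactin weak_star_topology H"
  shows "compactin weak_star_topology (convex hull \<Union>\<H>)"
  using assms
proof (induction \<H> rule: finite_induct)
  case (insert H \<H>)
  have "compactin weak_star_topology (convex hull (H \<union> convex hull \<Union>\<H>))"
    using insert by (intro compactin_convex_hull_Un) auto
  then show ?case by (simp flip: hull_Un_right)
qed simp

text \<open>Milman's converse to the Krein--Milman theorem, for extreme points of a dual ball. If the compact
  family \<open>E\<close> does not reach the restriction of \<open>\<tau>\<close> to \<open>K\<close>, then finitely many half-spaces cover the
  family and avoid \<open>\<tau>\<close>. As \<open>\<tau>\<close> is extreme, the convex hull of their intersections with the ball also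
  avoids \<open>\<tau>\<close>. But this hull is compact and contains a norming family, so it is the whole ball.\<close>

theorem extreme_point_in_norming_family:
  fixes \<tau> :: "'z::real_normed_vector dual"
  assumes \<tau>: "\<tau> extreme_point_of (cball 0 1)"
    and N: "compactin T N" and ball: "\<And>t. t \<in> N \<Longrightarrow> norm (E t) \<le> 1"
    and cont: "\<And>k. k \<in> K \<Longrightarrow> continuous_map T euclideanreal (\<lambda>t. blinfun_apply (E t) k)"
    and norming: "\<And>z \<eta>. \<eta> > 0 \<Longrightarrow> \<exists>t\<in>N. norm z - \<eta> < blinfun_apply (E t) z"
  shows "\<exists>t\<in>N. \<forall>k\<in>K. blinfun_apply (E t) k = blinfun_apply \<tau> k"
proof (rule ccontr)
  assume "\<not> ?thesis"
  then have sep: "\<exists>k\<in>K. blinfun_apply (E t) k \<noteq> blinfun_apply \<tau> k" if "t \<in> N" for t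
    using that by blast
  obtain A d where A: "finite A" "A \<subseteq> K" "d > 0"
    "\<And>t. t \<in> N \<Longrightarrow> \<exists>k\<in>A. d \<le> \<bar>blinfun_apply (E t) k - blinfun_apply \<tau> k\<bar>"
    by (rule compact_uniform_separation[where \<phi> = "\<lambda>k t. blinfun_apply (E t) k",
          OF N cont sep]) auto
  \<comment> \<open>The sign \<open>s\<close> splits each condition on the absolute value into two half-spaces.\<close>
  define H where "H = (\<lambda>(k, s :: real). {f \<in> cball 0 1. d \<le> s * (blinfun_apply f k - blinfun_apply \<tau> k)})"
  let ?\<H> = "H ` (A \<times> {1, -1})"
  let ?C = "convex hull \<Union>?\<H>"
  have H: "convex (H i) \<and> compactin weak_star_topology (H i)" for i
  proof -
    obtain k s where i: "i = (k, s)" by (cases i)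
    have convex: "convex (H i)"
      unfolding i H_def
    proof (clarsimp simp: convex_alt, intro conjI)
      fix f g and u :: real
      assume f: "norm f \<le> 1" "d \<le> s * (blinfun_apply f k - blinfun_apply \<tau> k)"
        and g: "norm g \<le> 1" "d \<le> s * (blinfun_apply g k - blinfun_apply \<tau> k)"
        and u: "0 \<le> u" "u \<le> 1"
      show "norm ((1 - u) *\<^sub>R f + u *\<^sub>R g) \<le> 1"
        using convexD_alt[OF convex_cball[of "0::'z dual" 1], of f g u] f g u by simp
      have "(1 - u) * d + u * d \<le> (1 - u) * (s * (blinfun_apply f k - blinfun_apply \<tau> k))
              + u * (s * (blinfun_apply g k - blinfun_apply \<tau> k))"
        using f g u by (intro add_mono mult_left_mono) auto
      then show "d \<le> s * (blinfun_apply ((1 - u) *\<^sub>R f + u *\<^sub>R g) k - blinfun_apply \<tau> k)"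
        by (simp add: blinfun.bilinear_simps algebra_simps)
    qed
    have "closedin weak_star_topology {f. d \<le> s * (blinfun_apply f k - blinfun_apply \<tau> k)}"
    proof -
      have "continuous_map weak_star_topology euclideanreal (\<lambda>f. s * (blinfun_apply f k - blinfun_apply \<tau> k))"
        by (intro continuous_intros continuous_map_weak_star_eval)
      from closedin_continuous_map_preimage[OF this, of "{d..}"] show ?thesis by simp
    qed
    then have "compactin weak_star_topology (cball 0 1 \<inter> {f. d \<le> s * (blinfun_apply f k - blinfun_apply \<tau> k)})"
      by (intro compact_Int_closedin compactin_weak_star_cball)
    moreover have "H i = cball 0 1 \<inter> {f. d \<le> s * (blinfun_apply f k - blinfun_apply \<tau> k)}"
      by (auto simp: i H_def)
    ultimately have "compactin weak_star_topology (H i)" by simp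
    with convex show ?thesis by blast
  qed
  have comp: "compactin weak_star_topology ?C"
    using A(1) H by (intro compactin_convex_hull_Union) auto
  have avoid: "?C \<subseteq> cball 0 1 - {\<tau>}"
  proof (rule hull_minimal)
    show "\<Union>?\<H> \<subseteq> cball 0 1 - {\<tau>}" using A(3) by (auto simp: H_def)
    show "convex (cball 0 1 - {\<tau>})"
      using \<tau> extreme_point_of_stillconvex[OF convex_cball] by blast
  qed
  have E: "E t \<in> ?C" if t: "t \<in> N" for t
  proof (rule hull_inc)
    obtain k where k: "k \<in> A" "d \<le> \<bar>blinfun_apply (E t) k - blinfun_apply \<tau> k\<bar>" using A(4)[OF t] by blast
    then have "E t \<in> H (k, 1) \<or> E t \<in> H (k, -1)" using ball[OF t] by (auto simp: H_def abs_if split: if_splits)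
    then show "E t \<in> \<Union>?\<H>" using k(1) by blast
  qed
  have "?C = cball 0 1"
  proof (rule norming_convex_compact_eq_cball[OF convex_convex_hull _ _ comp])
    show "\<exists>c\<in>?C. norm z - \<eta> < blinfun_apply c z" if "\<eta> > 0" for z and \<eta> :: real
      using norming[OF that, of z] E by blast
  qed (use avoid in blast)
  moreover have "\<tau> \<in> cball 0 1" using \<tau> by (simp add: extreme_point_of_def)
  ultimately show False using avoid by blast
qed

section \<open>M-ideals\<close>

definition M_ideal_projection :: "('z::real_normed_vector dual \<Rightarrow> 'z dual) \<Rightarrow> 'z set \<Rightarrow> bool" where
  "M_ideal_projection P M \<longleftrightarrow> linear P \<and> P \<circ> P = P \<and>
     (\<forall>f. norm (P f) + norm (f - P f) = norm f) \<and> {f. P f = 0} = annihilator M"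

lemma M_ideal_projectionD:
  assumes "M_ideal_projection P M"
  shows "linear P" "P (P f) = P f" "norm (P f) + norm (f - P f) = norm f"
    "P f = 0 \<longleftrightarrow> f \<in> annihilator M"
proof -
  have P: "linear P" "P \<circ> P = P" "\<forall>f. norm (P f) + norm (f - P f) = norm f" "{f. P f = 0} = annihilator M"
    using assms unfolding M_ideal_projection_def by blast+
  show "linear P" by (rule P)
  show "P (P f) = P f" using fun_cong[OF P(2), of f] by simp
  show "norm (P f) + norm (f - P f) = norm f" using P(3) by blast
  show "P f = 0 \<longleftrightarrow> f \<in> annihilator M" using P(4) by blast
qed

lemma M_ideal_projection_cong:
  assumes P: "M_ideal_projection P M" and "\<And>m. m \<in> M \<Longrightarrow> blinfun_apply f m = blinfun_apply g m"
  shows "P f = P g"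
proof -
  have "f - g \<in> annihilator M" using assms(2) by (simp add: annihilator_def blinfun.diff_left)
  then have "P (f - g) = 0" using M_ideal_projectionD(4)[OF P] by blast
  then show ?thesis by (simp add: linear_diff[OF M_ideal_projectionD(1)[OF P]])
qed

text \<open>A functional whose norm is already attained by its restriction to \<open>M\<close> lies in the range of the
  projection: \<open>P f\<close> has the same restriction, so \<open>f - P f\<close> has no norm left.\<close>

lemma M_ideal_projection_fixed:
  assumes P: "M_ideal_projection P M"
    and attained: "\<And>B. B \<ge> 0 \<Longrightarrow> (\<And>m. m \<in> M \<Longrightarrow> \<bar>blinfun_apply f m\<bar> \<le> B * norm m) \<Longrightarrow> norm f \<le> B"
  shows "P f = f"
proof -
  have "P (f - P f) = 0"
    using M_ideal_projectionD(2)[OF P] linear_diff[OF M_ideal_projectionD(1)[OF P]] by simp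
  then have "f - P f \<in> annihilator M" using M_ideal_projectionD(4)[OF P] by blast
  then have "blinfun_apply f m = blinfun_apply (P f) m" if "m \<in> M" for m
    using that by (auto simp: annihilator_def blinfun.diff_left)
  then have "norm f \<le> norm (P f)"
    using norm_blinfun[of "P f"] by (intro attained) auto
  then have "norm (f - P f) \<le> 0" using M_ideal_projectionD(3)[OF P, of f] by linarith
  then show ?thesis by simp
qed

text \<open>Norm-one functionals in the range of \<open>P\<close> are determined within the ball by their restriction to \<open>M\<close>,
  since \<open>P f = \<tau>\<close> already uses up the norm that \<open>f\<close> may have.\<close>

lemma M_ideal_unique_extension:
  assumes P: "M_ideal_projection P M" and \<tau>: "P \<tau> = \<tau>" "norm \<tau> = 1"
    and f: "norm f \<le> 1" "\<And>m. m \<in> M \<Longrightarrow> blinfun_apply f m = blinfun_apply \<tau> m"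
  shows "f = \<tau>"
proof -
  have "P f = \<tau>" using M_ideal_projection_cong[OF P f(2)] \<tau>(1) by simp
  then have "norm \<tau> + norm (f - \<tau>) = norm f" using M_ideal_projectionD(3)[OF P, of f] by metis
  then have "norm (f - \<tau>) \<le> 0" using \<tau>(2) f(1) by linarith
  then show ?thesis by simp
qed

text \<open>Within the ball, pointwise convergence on \<open>M\<close> to a norm-one functional in the range of \<open>P\<close>
  implies weak-star convergence: the ball is compact, and by unique extension there is only one
  possible weak-star cluster point.\<close>

lemma M_ideal_topcontinuous_extend:
  fixes \<tau> :: "'z::real_normed_vector dual"
  assumes P: "M_ideal_projection P M" and \<tau>: "P \<tau> = \<tau>" "norm \<tau> = 1"
    and G: "\<And>t. t \<in> topspace T \<Longrightarrow> norm (G t) \<le> 1" "G a = \<tau>" and a: "a \<in> topspace T"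
    and cont: "\<And>m. m \<in> M \<Longrightarrow> topcontinuous_at T euclideanreal (\<lambda>t. blinfun_apply (G t) m) a"
  shows "topcontinuous_at T euclideanreal (\<lambda>t. blinfun_apply (G t) z) a"
  unfolding topcontinuous_at_real_iff
proof (intro conjI allI impI a)
  fix e :: real assume e: "e > 0"
  let ?N = "cball 0 1 \<inter> {f. e \<le> \<bar>blinfun_apply f z - blinfun_apply \<tau> z\<bar>}"
  have "closedin weak_star_topology {f. e \<le> \<bar>blinfun_apply f z - blinfun_apply \<tau> z\<bar>}"
  proof -
    have "continuous_map weak_star_topology euclideanreal (\<lambda>f. \<bar>blinfun_apply f z - blinfun_apply \<tau> z\<bar>)"
      by (intro continuous_intros continuous_map_weak_star_eval)
    from closedin_continuous_map_preimage[OF this, of "{e..}"] show ?thesis by simp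
  qed
  then have N: "compactin weak_star_topology ?N"
    by (intro compact_Int_closedin compactin_weak_star_cball)
  have sep: "\<exists>m\<in>M. blinfun_apply f m \<noteq> blinfun_apply \<tau> m" if "f \<in> ?N" for f
  proof (rule ccontr)
    assume "\<not> ?thesis"
    then have "f = \<tau>" using that by (intro M_ideal_unique_extension[OF P \<tau>]) auto
    then show False using that e by simp
  qed
  obtain A d where A: "finite A" "A \<subseteq> M" "d > 0"
    "\<And>f. f \<in> ?N \<Longrightarrow> \<exists>m\<in>A. d \<le> \<bar>blinfun_apply f m - blinfun_apply \<tau> m\<bar>"
    by (rule compact_uniform_separation[where \<phi> = "\<lambda>z f. blinfun_apply f z",
          OF N continuous_map_weak_star_eval sep], assumption, rule that)
  have "\<exists>W. openin T W \<and> a \<in> W \<and> (\<forall>t\<in>W. \<bar>blinfun_apply (G t) m - blinfun_apply \<tau> m\<bar> < d)" if "m \<in> A" for m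
    using cont[of m] A(2,3) that G(2) unfolding topcontinuous_at_real_iff by (metis subsetD)
  then obtain W where W: "\<And>m. m \<in> A \<Longrightarrow> openin T (W m) \<and> a \<in> W m \<and>
      (\<forall>t\<in>W m. \<bar>blinfun_apply (G t) m - blinfun_apply \<tau> m\<bar> < d)" by metis
  let ?W = "(\<Inter>m\<in>A. W m) \<inter> topspace T"
  have "openin T ?W" using A(1) W by (intro openin_INT) blast+
  moreover have "a \<in> ?W" using W a by blast
  moreover have "\<bar>blinfun_apply (G t) z - blinfun_apply (G a) z\<bar> < e" if t: "t \<in> ?W" for t
  proof (rule ccontr)
    assume "\<not> ?thesis"
    then have "G t \<in> ?N" using t G by auto
    then obtain m where "m \<in> A" "d \<le> \<bar>blinfun_apply (G t) m - blinfun_apply \<tau> m\<bar>" using A(4) by blast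
    then show False using W[of m] t by force
  qed
  ultimately show "\<exists>U. openin T U \<and> a \<in> U \<and> (\<forall>t\<in>U. \<bar>blinfun_apply (G t) z - blinfun_apply (G a) z\<bar> < e)"
    by blast
qed

text \<open>The range of \<open>P\<close> is the common kernel of the functionals \<open>f \<mapsto> (f - P f) z\<close>, hence weakly
  closed. If its unit ball is norming, it is weak-star dense in the ball, so a point of continuity is
  a weak limit of elements of the range.\<close>

lemma M_ideal_pc_fixed:
  fixes \<tau> :: "'z::real_normed_vector dual"
  assumes P: "M_ideal_projection P M" and pc: "weak_star_weak_pc \<tau>"
    and norming: "\<And>z \<eta>. \<eta> > 0 \<Longrightarrow> \<exists>c. norm c \<le> 1 \<and> P c = c \<and> norm z - \<eta> < blinfun_apply c z"
  shows "P \<tau> = \<tau>"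
proof (rule ccontr)
  note lin = M_ideal_projectionD(1)[OF P]
  assume "P \<tau> \<noteq> \<tau>"
  then obtain z where z: "blinfun_apply (\<tau> - P \<tau>) z \<noteq> 0"
    using blinfun_eqI[of "\<tau> - P \<tau>" 0] by auto
  let ?h = "\<lambda>f. blinfun_apply (f - P f) z"
  have "bounded_linear ?h"
  proof (rule bounded_linear_intro[where K = "norm z"])
    show "?h (f + g) = ?h f + ?h g" for f g
      by (simp add: linear_add[OF lin] blinfun.bilinear_simps)
    show "?h (r *\<^sub>R f) = r *\<^sub>R ?h f" for r f
      by (simp add: linear_scale[OF lin] blinfun.bilinear_simps algebra_simps)
    have "norm (?h f) \<le> norm (f - P f) * norm z" for f by (rule norm_blinfun)
    moreover have "norm (f - P f) \<le> norm f" for f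
      using M_ideal_projectionD(3)[OF P, of f] norm_ge_zero[of "P f"] by linarith
    ultimately show "norm (?h f) \<le> norm f * norm z" for f
      by (meson mult_right_mono norm_ge_zero order_trans)
  qed
  then have h: "blinfun_apply (Blinfun ?h) = ?h" by (rule bounded_linear_Blinfun_apply)
  have "topcontinuous_at dual_ball_topology euclideanreal (blinfun_apply (Blinfun ?h)) \<tau>"
    using pc weak_star_weak_pc_iff[of \<tau>] by blast
  then have cont: "topcontinuous_at dual_ball_topology euclideanreal ?h \<tau>" unfolding h .
  have "0 < \<bar>?h \<tau>\<bar>" using z by simp
  from cont[unfolded topcontinuous_at_real_iff, THEN conjunct2, rule_format, OF this]
  obtain U where U: "openin dual_ball_topology U" "\<tau> \<in> U"
    "\<forall>f\<in>U. \<bar>?h f - ?h \<tau>\<bar> < \<bar>?h \<tau>\<bar>"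
    by blast
  let ?C = "{c. norm c \<le> 1 \<and> P c = c}"
  have "convex ?C"
  proof (clarsimp simp: convex_alt, intro conjI)
    fix f g and u :: real
    assume fg: "norm f \<le> 1" "P f = f" "norm g \<le> 1" "P g = g" and u: "0 \<le> u" "u \<le> 1"
    show "norm ((1 - u) *\<^sub>R f + u *\<^sub>R g) \<le> 1"
      using convexD_alt[OF convex_cball[of "0::'z dual" 1], of f g u] fg u by simp
    show "P ((1 - u) *\<^sub>R f + u *\<^sub>R g) = (1 - u) *\<^sub>R f + u *\<^sub>R g"
      using fg by (simp add: linear_add[OF lin] linear_scale[OF lin])
  qed
  then have "?C \<inter> U \<noteq> {}"
    using norming by (intro norming_convex_dense[OF _ _ _ U(1,2)]) auto
  then obtain c where "P c = c" "c \<in> U" by blast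
  then show False using U(3)[rule_format, of c] by simp
qed

section \<open>Elementary tensors as functionals on operators\<close>

lemma tensor_functional_apply:
  "blinfun_apply (tensor_functional x y) S = blinfun_apply x (y o\<^sub>L S)"
  by (simp add: tensor_functional.rep_eq dual_operator.rep_eq)

lemma norm_tensor_functional_le:
  "norm (tensor_functional x y) \<le> norm x * norm y"
proof (rule norm_blinfun_bound)
  fix S
  have "norm (blinfun_apply (tensor_functional x y) S) \<le> norm x * norm (y o\<^sub>L S)"
    unfolding tensor_functional_apply by (rule norm_blinfun)
  also have "\<dots> \<le> norm x * (norm y * norm S)"
    by (intro mult_left_mono norm_blinfun_compose) simp
  finally show "norm (blinfun_apply (tensor_functional x y) S) \<le> norm x * norm y * norm S"
    by (simp add: mult.assoc)
qed simp

lemma norm_tensor_functional_le_one: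
  assumes "norm x \<le> 1" "norm y \<le> 1" shows "norm (tensor_functional x y) \<le> 1"
  using norm_tensor_functional_le[of x y] mult_mono[of "norm x" 1 "norm y" 1] assms by simp

definition rank_one :: "'x::real_normed_vector dual \<Rightarrow> 'y::real_normed_vector \<Rightarrow> 'x \<Rightarrow>\<^sub>L 'y" where
  "rank_one f v = blinfun_scaleR_left v o\<^sub>L f"

lemma rank_one_apply: "blinfun_apply (rank_one f v) a = blinfun_apply f a *\<^sub>R v"
  by (simp add: rank_one_def)

lemma compose_rank_one: "y o\<^sub>L rank_one f v = blinfun_apply y v *\<^sub>R f"
  by (rule blinfun_eqI) (simp add: rank_one_apply blinfun.bilinear_simps)

lemma tensor_functional_rank_one:
  "blinfun_apply (tensor_functional x y) (rank_one f v) = blinfun_apply y v * blinfun_apply x f"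
  by (simp add: tensor_functional_apply compose_rank_one blinfun.scaleR_right)

lemma norm_rank_one_le: "norm (rank_one f v) \<le> norm f * norm v"
proof (rule norm_blinfun_bound)
  show "norm (blinfun_apply (rank_one f v) a) \<le> norm f * norm v * norm a" for a
    using mult_right_mono[OF norm_blinfun[of f a] norm_ge_zero[of v]]
    by (simp add: rank_one_apply mult_ac)
qed simp

lemma rank_one_compact: "rank_one f v \<in> compact_operators"
proof -
  have "blinfun_apply (rank_one f v) ` cball 0 1 \<subseteq> (\<lambda>r. r *\<^sub>R v) ` {- norm f..norm f}"
  proof
    fix w assume "w \<in> blinfun_apply (rank_one f v) ` cball 0 1"
    then obtain a where a: "norm a \<le> 1" "w = blinfun_apply f a *\<^sub>R v" by (auto simp: rank_one_apply)
    have "\<bar>blinfun_apply f a\<bar> \<le> norm f"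
      using norm_blinfun[of f a] mult_left_mono[OF a(1) norm_ge_zero[of f]] by simp
    then show "w \<in> (\<lambda>r. r *\<^sub>R v) ` {- norm f..norm f}"
      using a(2) by (intro image_eqI[of _ _ "blinfun_apply f a"]) (auto simp: abs_le_iff)
  qed
  moreover have K: "compact ((\<lambda>r. r *\<^sub>R v) ` {- norm f..norm f})"
    by (intro compact_continuous_image continuous_intros) simp
  ultimately have "closure (blinfun_apply (rank_one f v) ` cball 0 1) \<subseteq> (\<lambda>r. r *\<^sub>R v) ` {- norm f..norm f}"
    by (intro closure_minimal compact_imp_closed)
  then have "compact (closure (blinfun_apply (rank_one f v) ` cball 0 1))"
    using compact_Int_closed[OF K closed_closure] by (metis Int_absorb1)
  then show ?thesis by (simp add: compact_operators_def)
qed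

text \<open>Testing on \<open>rank_one f v\<close> separates the factors: the value is \<open>y v * x f\<close>, so the norms of \<open>x\<close> and \<open>y\<close>
  can be approached one after the other.\<close>

lemma norm_tensor_functional_attained:
  fixes x :: "'x::real_normed_vector dual dual" and y :: "'y::real_normed_vector dual"
  assumes B: "B \<ge> 0"
    and bound: "\<And>S. S \<in> compact_operators \<Longrightarrow> \<bar>blinfun_apply (tensor_functional x y) S\<bar> \<le> B * norm S"
  shows "norm (tensor_functional x y) \<le> B"
proof -
  have "\<bar>blinfun_apply y v * blinfun_apply x f\<bar> \<le> B * norm v * norm f" for v f
  proof -
    have "\<bar>blinfun_apply y v * blinfun_apply x f\<bar> \<le> B * norm (rank_one f v)"
      using bound[OF rank_one_compact, of f v] by (simp add: tensor_functional_rank_one)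
    also have "\<dots> \<le> B * (norm f * norm v)" by (intro mult_left_mono norm_rank_one_le B)
    finally show ?thesis by (simp add: mult_ac)
  qed
  then have "norm (blinfun_apply y v *\<^sub>R x) \<le> B * norm v" for v
    using B by (intro norm_blinfun_bound) (auto simp: blinfun.scaleR_left)
  then have "norm (norm x *\<^sub>R y) \<le> B"
    using B by (intro norm_blinfun_bound) (auto simp: blinfun.scaleR_left abs_mult mult.commute)
  then show ?thesis using norm_tensor_functional_le[of x y] by simp
qed

lemma M_ideal_projection_tensor_functional:
  assumes "M_ideal_projection P compact_operators"
  shows "P (tensor_functional x y) = tensor_functional x y"
  using norm_tensor_functional_attained by (intro M_ideal_projection_fixed[OF assms]) blast

lemma norm_blinfun_le_on_ball:
  fixes S :: "'a::real_normed_vector \<Rightarrow>\<^sub>L 'b::real_normed_vector"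
  assumes "\<And>a. norm a \<le> 1 \<Longrightarrow> norm (blinfun_apply S a) \<le> b"
  shows "norm S \<le> b"
proof (rule norm_blinfun_bound)
  show "0 \<le> b" using assms[of 0] by (simp add: blinfun.zero_right)
  show "norm (blinfun_apply S a) \<le> b * norm a" for a
  proof (cases "a = 0")
    case False
    then have "norm (blinfun_apply S ((1 / norm a) *\<^sub>R a)) \<le> b" by (intro assms) simp
    then show ?thesis using False by (simp add: blinfun.scaleR_right field_simps)
  qed (simp add: blinfun.zero_right)
qed

text \<open>Here \<open>x\<close> is evaluation at a vector where \<open>S\<close> almost attains its norm, and \<open>y\<close> norms its image.\<close>

lemma tensor_functionals_norming:
  fixes S :: "'x::real_normed_vector \<Rightarrow>\<^sub>L 'y::real_normed_vector"
  assumes "\<eta> > 0"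
  obtains x :: "'x dual dual" and y :: "'y dual"
  where "norm x \<le> 1" "norm y \<le> 1" "norm S - \<eta> < blinfun_apply (tensor_functional x y) S"
proof -
  obtain a where a: "norm a \<le> 1" "norm S - \<eta> < norm (blinfun_apply S a)"
    using norm_blinfun_le_on_ball[of S "norm S - \<eta>"] assms by (force simp: not_le[symmetric])
  obtain y :: "'y dual" where y: "norm y \<le> 1" "blinfun_apply y (blinfun_apply S a) = norm (blinfun_apply S a)"
    by (rule norming_functional)
  let ?x = "Blinfun (\<lambda>f :: 'x dual. blinfun_apply f a)"
  have x: "blinfun_apply ?x f = blinfun_apply f a" for f
    by (simp add: bounded_linear_Blinfun_apply blinfun.bounded_linear_left)
  have "norm ?x \<le> 1"
  proof (rule norm_blinfun_bound)
    fix f :: "'x dual"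
    show "norm (blinfun_apply ?x f) \<le> 1 * norm f"
      unfolding x using norm_blinfun[of f a] mult_left_mono[OF a(1) norm_ge_zero[of f]] by simp
  qed simp
  then show thesis using that[of ?x y] y a(2) by (simp add: tensor_functional_apply x)
qed

text \<open>On compact operators, elementary tensors depend jointly continuously on their factors: the image of
  the ball has a finite net \<open>F\<close>, so a functional \<open>y\<close> close to \<open>y\<^sub>0\<close> at the points of \<open>F\<close> satisfies
  \<open>y \<circ> S \<approx> y\<^sub>0 \<circ> S\<close> in norm.\<close>

lemma continuous_map_tensor_functional:
  fixes S :: "'x::real_normed_vector \<Rightarrow>\<^sub>L 'y::real_normed_vector"
  assumes S: "S \<in> compact_operators"
  shows "continuous_map (prod_topology dual_ball_topology dual_ball_topology) euclideanreal
           (\<lambda>p. blinfun_apply (tensor_functional (fst p) (snd p)) S)"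
  unfolding continuous_map_eq_topcontinuous_at topcontinuous_at_real_iff
proof (clarsimp simp: tensor_functional_apply)
  fix x0 :: "'x dual dual" and y0 :: "'y dual" and e :: real
  assume x0: "norm x0 \<le> 1" and y0: "norm y0 \<le> 1" and "e > 0"
  define d where "d = e / 4"
  have d: "d > 0" using \<open>e > 0\<close> by (simp add: d_def)
  have "compact (closure (blinfun_apply S ` cball 0 1))" using S by (simp add: compact_operators_def)
  then obtain F where F: "finite F" "closure (blinfun_apply S ` cball 0 1) \<subseteq> (\<Union>k\<in>F. ball k d)"
    using d unfolding compact_eq_totally_bounded by meson
  have ev: "openin dual_ball_topology {f \<in> cball 0 1. \<bar>blinfun_apply f z - c\<bar> < d}"
    for z :: "'z::real_normed_vector" and c
  proof -
    have "continuous_map dual_ball_topology euclideanreal (\<lambda>f. \<bar>blinfun_apply f z - c\<bar>)"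
      by (intro continuous_intros continuous_map_from_subtopology[OF continuous_map_weak_star_eval])
    from openin_continuous_map_preimage[OF this, of "{..<d}"] show ?thesis by simp
  qed
  let ?U = "{x \<in> cball 0 1. \<bar>blinfun_apply x (y0 o\<^sub>L S) - blinfun_apply x0 (y0 o\<^sub>L S)\<bar> < d}"
  let ?V = "(\<Inter>k\<in>F. {y \<in> cball 0 1. \<bar>blinfun_apply y k - blinfun_apply y0 k\<bar> < d}) \<inter> topspace dual_ball_topology"
  have "openin dual_ball_topology ?V" using F(1) ev by (intro openin_INT) auto
  then have "openin (prod_topology dual_ball_topology dual_ball_topology) (?U \<times> ?V)"
    by (intro openin_prod_Times_iff[THEN iffD2] disjI2 conjI ev)
  moreover have "(x0, y0) \<in> ?U \<times> ?V" using x0 y0 d by auto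
  moreover have near: "\<bar>blinfun_apply x (y o\<^sub>L S) - blinfun_apply x0 (y0 o\<^sub>L S)\<bar> < e" if xy: "(x, y) \<in> ?U \<times> ?V" for x y
  proof -
    have x: "norm x \<le> 1" "\<bar>blinfun_apply x (y0 o\<^sub>L S) - blinfun_apply x0 (y0 o\<^sub>L S)\<bar> < d" using xy by auto
    have y: "norm y \<le> 1" "\<And>k. k \<in> F \<Longrightarrow> \<bar>blinfun_apply y k - blinfun_apply y0 k\<bar> < d" using xy by auto
    have "norm ((y - y0) o\<^sub>L S) \<le> 3 * d"
    proof (rule norm_blinfun_le_on_ball)
      fix a :: 'x assume "norm a \<le> 1"
      then have "blinfun_apply S a \<in> closure (blinfun_apply S ` cball 0 1)"
        by (intro subsetD[OF closure_subset]) auto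
      then obtain k where k: "k \<in> F" "dist k (blinfun_apply S a) < d" using F(2) by auto
      have small: "\<bar>blinfun_apply f (blinfun_apply S a - k)\<bar> \<le> d" if "norm f \<le> 1" for f :: "'y dual"
      proof -
        have "\<bar>blinfun_apply f (blinfun_apply S a - k)\<bar> \<le> norm f * norm (blinfun_apply S a - k)"
          using norm_blinfun[of f] by simp
        also have "\<dots> \<le> 1 * d"
          using k(2) that by (intro mult_mono) (auto simp: dist_norm norm_minus_commute)
        finally show ?thesis by simp
      qed
      show "norm (blinfun_apply ((y - y0) o\<^sub>L S) a) \<le> 3 * d"
        using small[OF y(1)] small[OF y0] y(2)[OF k(1)]
        by (simp add: blinfun.bilinear_simps abs_le_iff abs_less_iff)
    qed
    then have "\<bar>blinfun_apply x ((y - y0) o\<^sub>L S)\<bar> \<le> 3 * d"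
      using norm_blinfun[of x "(y - y0) o\<^sub>L S"] mult_mono[OF x(1) _ zero_le_one norm_ge_zero, of "(y - y0) o\<^sub>L S" "3 * d"]
      by simp
    moreover have "y o\<^sub>L S = ((y - y0) o\<^sub>L S) + (y0 o\<^sub>L S)"
      by (rule blinfun_eqI) (simp add: blinfun.bilinear_simps)
    then have "blinfun_apply x (y o\<^sub>L S) = blinfun_apply x ((y - y0) o\<^sub>L S) + blinfun_apply x (y0 o\<^sub>L S)"
      by (simp add: blinfun.add_right)
    ultimately show ?thesis using x(2) unfolding d_def by linarith
  qed
  then have "\<forall>t\<in>?U \<times> ?V. \<bar>blinfun_apply (fst t) (snd t o\<^sub>L S) - blinfun_apply x0 (y0 o\<^sub>L S)\<bar> < e"
    by (intro ballI near) (simp only: prod.collapse)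
  ultimately show "\<exists>U. openin (prod_topology dual_ball_topology dual_ball_topology) U \<and> (x0, y0) \<in> U \<and>
      (\<forall>t\<in>U. \<bar>blinfun_apply (fst t) (snd t o\<^sub>L S) - blinfun_apply x0 (y0 o\<^sub>L S)\<bar> < e)"
    by (intro exI[of _ "?U \<times> ?V"] conjI)
qed

lemma extreme_point_of_linear_preimage:
  fixes L :: "'a::real_normed_vector \<Rightarrow> 'b::real_normed_vector"
  assumes "linear L" "inj L" and ball: "\<And>a. a \<in> S \<Longrightarrow> L a \<in> T"
    and "L x extreme_point_of T" "x \<in> S"
  shows "x extreme_point_of S"
  unfolding extreme_point_of_def
proof (intro conjI ballI notI)
  fix a b assume ab: "a \<in> S" "b \<in> S" "x \<in> open_segment a b"
  then have "L x \<in> open_segment (L a) (L b)"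
    using open_segment_linear_image[OF assms(1,2), of a b] by blast
  then show False using assms(4) ball ab unfolding extreme_point_of_def by blast
qed (rule assms)

lemma extreme_point_of_cball_norm:
  fixes x v :: "'a::real_normed_vector"
  assumes "x extreme_point_of cball 0 1" "v \<noteq> 0" "norm v \<le> 1"
  shows "norm x = 1"
proof (rule ccontr)
  assume "norm x \<noteq> 1"
  moreover have "norm x \<le> 1" using assms(1) by (simp add: extreme_point_of_def)
  ultimately have "x \<in> ball 0 1" by simp
  then have "x \<in> rel_interior (cball 0 1)"
    using interior_maximal[OF ball_subset_cball open_ball, of 0 1] interior_subset_rel_interior by blast
  moreover have "cball 0 1 \<noteq> {x}" using assms(2,3) by (metis centre_in_cball mem_cball_0 singletonD zero_le_one)
  ultimately show False using extreme_point_not_in_REL_INTERIOR[OF assms(1)] by blast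
qed

section \<open>Points of continuity of the ball of functionals on operators\<close>

text \<open>With one factor fixed and nonzero, the elementary tensor is a linear injection of one ball into
  another; this pulls extremality back to the other factor.\<close>

lemma tensor_functional_extreme_left:
  fixes x :: "'x::real_normed_vector dual dual" and y :: "'y::real_normed_vector dual"
  assumes "tensor_functional x y extreme_point_of cball 0 1" "norm x \<le> 1" "norm y \<le> 1"
    and v: "blinfun_apply y v \<noteq> 0"
  shows "x extreme_point_of cball 0 1"
proof (rule extreme_point_of_linear_preimage[where L = "\<lambda>x. tensor_functional x y"])
  show "linear (\<lambda>x. tensor_functional x y)"
    by (intro linearI blinfun_eqI) (simp_all add: tensor_functional_apply blinfun.bilinear_simps)
  show "inj (\<lambda>x :: 'x dual dual. tensor_functional x y)"
  proof (intro injI blinfun_eqI)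
    fix a b :: "'x dual dual" and f assume "tensor_functional a y = tensor_functional b y"
    then have "blinfun_apply (tensor_functional a y) (rank_one f v) = blinfun_apply (tensor_functional b y) (rank_one f v)"
      by simp
    then show "blinfun_apply a f = blinfun_apply b f" using v by (simp add: tensor_functional_rank_one)
  qed
qed (use assms norm_tensor_functional_le_one in auto)

lemma tensor_functional_extreme_right:
  fixes x :: "'x::real_normed_vector dual dual" and y :: "'y::real_normed_vector dual"
  assumes "tensor_functional x y extreme_point_of cball 0 1" "norm x \<le> 1" "norm y \<le> 1"
    and f: "blinfun_apply x f \<noteq> 0"
  shows "y extreme_point_of cball 0 1"
proof (rule extreme_point_of_linear_preimage[where L = "tensor_functional x"])
  have add: "(a + b) o\<^sub>L S = (a o\<^sub>L S) + (b o\<^sub>L S)" for a b :: "'y dual" and S :: "'x \<Rightarrow>\<^sub>L 'y"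
    by (rule blinfun_eqI) (simp add: blinfun.bilinear_simps)
  have scale: "(r *\<^sub>R a) o\<^sub>L S = r *\<^sub>R (a o\<^sub>L S)" for a :: "'y dual" and S :: "'x \<Rightarrow>\<^sub>L 'y" and r
    by (rule blinfun_eqI) (simp add: blinfun.bilinear_simps)
  show "linear (tensor_functional x :: 'y dual \<Rightarrow> ('x \<Rightarrow>\<^sub>L 'y) dual)"
    by (intro linearI blinfun_eqI) (simp_all add: tensor_functional_apply add scale blinfun.bilinear_simps)
  show "inj (tensor_functional x :: 'y dual \<Rightarrow> ('x \<Rightarrow>\<^sub>L 'y) dual)"
  proof (intro injI blinfun_eqI)
    fix a b :: "'y dual" and v assume "tensor_functional x a = tensor_functional x b"
    then have "blinfun_apply (tensor_functional x a) (rank_one f v) = blinfun_apply (tensor_functional x b) (rank_one f v)"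
      by simp
    then show "blinfun_apply a v = blinfun_apply b v" using f by (simp add: tensor_functional_rank_one)
  qed
qed (use assms norm_tensor_functional_le_one in auto)

text \<open>The map \<open>x \<mapsto> tensor_functional x y\<close> is weak-star continuous, and up to the factor \<open>y v\<close> it has the
  adjoint of \<open>f \<mapsto> rank_one f v\<close> as a left inverse, through which all functionals factor.\<close>

lemma tensor_functional_pc_left:
  fixes x :: "'x::real_normed_vector dual dual" and y :: "'y::real_normed_vector dual"
  assumes pc: "weak_star_weak_pc (tensor_functional x y)" and x: "norm x \<le> 1" and y: "norm y \<le> 1"
    and v: "blinfun_apply y v \<noteq> 0"
  shows "weak_star_weak_pc x"
proof (rule weak_star_weak_pc_transfer[where G = "\<lambda>x. tensor_functional x y"])
  show "topcontinuous_at dual_ball_topology euclideanreal (\<lambda>b. blinfun_apply (tensor_functional b y) S) x" for S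
  proof -
    have "continuous_map dual_ball_topology euclideanreal (\<lambda>b. blinfun_apply b (y o\<^sub>L S))"
      by (rule continuous_map_from_subtopology[OF continuous_map_weak_star_eval])
    then show ?thesis
      using x unfolding continuous_map_eq_topcontinuous_at tensor_functional_apply by simp
  qed
  fix F :: "'x dual dual dual"
  let ?R = "Blinfun (\<lambda>f :: 'x dual. rank_one f v)"
  have "bounded_linear (\<lambda>f :: 'x dual. rank_one f v)"
    unfolding rank_one_def
    by (rule bounded_bilinear.bounded_linear_right[OF bounded_bilinear_blinfun_compose])
  then have R: "blinfun_apply ?R f = rank_one f v" for f by (simp add: bounded_linear_Blinfun_apply)
  have "blinfun_apply (dual_operator ?R) (tensor_functional b y) = blinfun_apply y v *\<^sub>R b" for b
    by (rule blinfun_eqI) (simp add: dual_operator.rep_eq R tensor_functional_rank_one blinfun.scaleR_left)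
  then show "\<exists>\<Phi> :: ('x \<Rightarrow>\<^sub>L 'y) dual dual. \<forall>b. blinfun_apply F b = blinfun_apply \<Phi> (tensor_functional b y)"
    using v by (intro exI[of _ "(1 / blinfun_apply y v) *\<^sub>R (F o\<^sub>L dual_operator ?R)"])
      (simp add: blinfun.scaleR_left blinfun.scaleR_right)
qed (use assms norm_tensor_functional_le_one in auto)

text \<open>For the other factor the map \<open>y \<mapsto> tensor_functional x y\<close> is only continuous when tested on compact
  operators, since \<open>x\<close> need not be weak-star continuous. At the given point the M-ideal property
  extends this to all operators.\<close>

lemma tensor_functional_pc_right:
  fixes x :: "'x::real_normed_vector dual dual" and y :: "'y::real_normed_vector dual"
  assumes P: "M_ideal_projection P (compact_operators :: ('x \<Rightarrow>\<^sub>L 'y) set)"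
    and norm: "norm (tensor_functional x y) = 1"
    and pc: "weak_star_weak_pc (tensor_functional x y)" and x: "norm x \<le> 1" and y: "norm y \<le> 1"
    and f: "blinfun_apply x f \<noteq> 0"
  shows "weak_star_weak_pc y"
proof (rule weak_star_weak_pc_transfer[where G = "tensor_functional x"])
  show "topcontinuous_at dual_ball_topology euclideanreal (\<lambda>b. blinfun_apply (tensor_functional x b) S) y" for S
  proof (rule M_ideal_topcontinuous_extend[where G = "tensor_functional x" and a = y,
        OF P M_ideal_projection_tensor_functional[OF P] norm _ refl])
    fix S :: "'x \<Rightarrow>\<^sub>L 'y" assume S: "S \<in> compact_operators"
    have "continuous_map dual_ball_topology (prod_topology dual_ball_topology dual_ball_topology) (\<lambda>b :: 'y dual. (x, b))"
      using x by (intro continuous_map_pairedI continuous_map_id[unfolded id_def]) simp_all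
    from continuous_map_compose[OF this continuous_map_tensor_functional[OF S]]
    show "topcontinuous_at dual_ball_topology euclideanreal (\<lambda>b. blinfun_apply (tensor_functional x b) S) y"
      using y unfolding continuous_map_eq_topcontinuous_at by (simp add: o_def)
  qed (use x y norm_tensor_functional_le_one in auto)
  fix F :: "'y dual dual"
  let ?R = "Blinfun (rank_one f :: 'y \<Rightarrow> 'x \<Rightarrow>\<^sub>L 'y)"
  have "bounded_linear (rank_one f :: 'y \<Rightarrow> 'x \<Rightarrow>\<^sub>L 'y)"
    unfolding rank_one_def
    by (intro bounded_linear_compose[OF bounded_bilinear.bounded_linear_left[OF bounded_bilinear_blinfun_compose]]
        bounded_linear_blinfun_scaleR_left)
  then have R: "blinfun_apply ?R v = rank_one f v" for v by (simp add: bounded_linear_Blinfun_apply)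
  have "blinfun_apply (dual_operator ?R) (tensor_functional x b) = blinfun_apply x f *\<^sub>R b" for b
    by (rule blinfun_eqI) (simp add: dual_operator.rep_eq R tensor_functional_rank_one blinfun.scaleR_left)
  then show "\<exists>\<Phi> :: ('x \<Rightarrow>\<^sub>L 'y) dual dual. \<forall>b. blinfun_apply F b = blinfun_apply \<Phi> (tensor_functional x b)"
    using f by (intro exI[of _ "(1 / blinfun_apply x f) *\<^sub>R (F o\<^sub>L dual_operator ?R)"])
      (simp add: blinfun.scaleR_left blinfun.scaleR_right)
qed (use assms norm_tensor_functional_le_one in auto)

text \<open>Between nonzero spaces there are rank-one operators, hence nonzero functionals on operators. In
  a nonzero space the interior of the unit ball has no extreme points.\<close>

lemma extreme_functional_on_operators_norm:
  fixes \<tau> :: "('x::real_normed_vector \<Rightarrow>\<^sub>L 'y::real_normed_vector) dual"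
  assumes "(UNIV :: 'x set) \<noteq> {0}" and "(UNIV :: 'y set) \<noteq> {0}"
    and \<tau>: "\<tau> extreme_point_of (cball 0 1)"
  shows "norm \<tau> = 1"
proof -
  obtain a :: 'x and v :: 'y where av: "a \<noteq> 0" "v \<noteq> 0" using assms(1,2) by blast
  obtain f :: "'x dual" where f: "blinfun_apply f a = norm a" by (rule norming_functional)
  have "blinfun_apply (rank_one f v) a \<noteq> 0" using f av by (simp add: rank_one_apply)
  then have S: "rank_one f v \<noteq> 0" by auto
  obtain w :: "('x \<Rightarrow>\<^sub>L 'y) dual" where w: "norm w \<le> 1" "blinfun_apply w (rank_one f v) = norm (rank_one f v)"
    by (rule norming_functional)
  have "w \<noteq> 0" using w(2) S by auto
  then show ?thesis using extreme_point_of_cball_norm[OF \<tau>] w(1) by blast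
qed

theorem proposition21:
  fixes \<tau> :: "('x::banach \<Rightarrow>\<^sub>L 'y::banach) dual"
  assumes "(UNIV :: 'x set) \<noteq> {0}" and "(UNIV :: 'y set) \<noteq> {0}"
    and "M_ideal (compact_operators :: ('x \<Rightarrow>\<^sub>L 'y) set)"
    and "\<tau> extreme_point_of (cball 0 1)"
    and "weak_star_weak_pc \<tau>"
  shows "\<exists>(x :: 'x dual dual) (y :: 'y dual).
           \<tau> = tensor_functional x y \<and>
           x extreme_point_of (cball 0 1) \<and> weak_star_weak_pc x \<and>
           y extreme_point_of (cball 0 1) \<and> weak_star_weak_pc y"
proof -
  obtain P where P: "M_ideal_projection P (compact_operators :: ('x \<Rightarrow>\<^sub>L 'y) set)"
    using assms(3) unfolding M_ideal_def M_ideal_projection_def by blast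
  have \<tau>_fixed: "P \<tau> = \<tau>"
  proof (rule M_ideal_pc_fixed[OF P assms(5)])
    fix S :: "'x \<Rightarrow>\<^sub>L 'y" and \<eta> :: real assume "\<eta> > 0"
    then obtain x :: "'x dual dual" and y :: "'y dual"
      where "norm x \<le> 1" "norm y \<le> 1" "norm S - \<eta> < blinfun_apply (tensor_functional x y) S"
      by (rule tensor_functionals_norming)
    then show "\<exists>c. norm c \<le> 1 \<and> P c = c \<and> norm S - \<eta> < blinfun_apply c S"
      using norm_tensor_functional_le_one M_ideal_projection_tensor_functional[OF P] by blast
  qed
  let ?B = "cball (0 :: 'x dual dual) 1 \<times> cball (0 :: 'y dual) 1"
  let ?T = "prod_topology (dual_ball_topology :: 'x dual dual topology) (dual_ball_topology :: 'y dual topology)"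
  have "\<exists>p\<in>?B. \<forall>S\<in>compact_operators.
      blinfun_apply (tensor_functional (fst p) (snd p)) S = blinfun_apply \<tau> S"
  proof (rule extreme_point_in_norming_family[OF assms(4)])
    show "compactin ?T ?B"
      using compact_space_dual_ball[where 'a = "'x dual"] compact_space_dual_ball[where 'a = 'y]
      by (simp add: compactin_Times compact_space_def)
    show "norm (tensor_functional (fst p) (snd p)) \<le> 1" if "p \<in> ?B" for p
      using that norm_tensor_functional_le_one by auto
    show "continuous_map ?T euclideanreal (\<lambda>p. blinfun_apply (tensor_functional (fst p) (snd p)) S)"
      if "S \<in> compact_operators" for S
      using that by (rule continuous_map_tensor_functional)
    show "\<exists>p\<in>?B. norm S - \<eta> < blinfun_apply (tensor_functional (fst p) (snd p)) S" if \<eta>: "\<eta> > 0" for S and \<eta> :: real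
    proof -
      obtain x :: "'x dual dual" and y :: "'y dual"
        where "norm x \<le> 1" "norm y \<le> 1" "norm S - \<eta> < blinfun_apply (tensor_functional x y) S"
        using \<eta> by (rule tensor_functionals_norming)
      then show ?thesis by (intro bexI[of _ "(x, y)"]) auto
    qed
  qed
  then obtain x :: "'x dual dual" and y :: "'y dual" where xy: "norm x \<le> 1" "norm y \<le> 1"
    and eq: "\<And>S. S \<in> compact_operators \<Longrightarrow> blinfun_apply (tensor_functional x y) S = blinfun_apply \<tau> S"
    by auto
  have \<tau>: "\<tau> = tensor_functional x y"
    using M_ideal_projection_cong[OF P eq] M_ideal_projection_tensor_functional[OF P] \<tau>_fixed by metis
  have norm: "norm \<tau> = 1" by (rule extreme_functional_on_operators_norm[OF assms(1,2,4)])
  then have "x \<noteq> 0" "y \<noteq> 0" using norm_tensor_functional_le[of x y] \<tau> by auto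
  then obtain f v where f: "blinfun_apply x f \<noteq> 0" and v: "blinfun_apply y v \<noteq> 0"
    using blinfun_eqI[of x 0] blinfun_eqI[of y 0] by auto
  have "x extreme_point_of cball 0 1"
    by (rule tensor_functional_extreme_left[OF _ xy v]) (use assms(4) \<tau> in simp)
  moreover have "y extreme_point_of cball 0 1"
    by (rule tensor_functional_extreme_right[OF _ xy f]) (use assms(4) \<tau> in simp)
  moreover have "weak_star_weak_pc x"
    by (rule tensor_functional_pc_left[OF _ xy v]) (use assms(5) \<tau> in simp)
  moreover have "weak_star_weak_pc y"
    by (rule tensor_functional_pc_right[OF P _ _ xy f]) (use assms(5) norm \<tau> in simp_all)
  ultimately show ?thesis using \<tau> by blast
qed

end
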